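(* Let $h:\mathbb{R}^n\to\mathbb{R}\cup\{+\infty\}$ be proper, lower semicontinuous and $\gamma_h$-prox-bounded. Then, for every $0<\mu<\lambda<\gamma_h$, the Lasry--Lions envelope $h^{\lambda,\mu}$ is $L_{h^{\lambda,\mu}}$-Lipschitz-continuously differentiable with gradient $$\nabla h^{\lambda,\mu}=\tfrac{\lambda}{\mu}P-\tfrac{1}{\mu}\mathrm{id},$$ where $P(x):=\operatorname{prox}_{c^{-1}(h+\lambda^{-1}j)^*}\big(\tfrac{x}{\lambda-\mu}\big)$, $j:=\tfrac12\|\cdot\|^2$, and $c:=\frac{\lambda(\lambda-\mu)}{\mu}$. In fact, for every $x,y\in\mathbb{R}^n$ it holds that $$\sigma_{h^{\lambda,\mu}}\|x-y\|^2\le\langle\nabla h^{\lambda,\mu}(x)-\nabla h^{\lambda,\mu}(y),\,x-y\rangle\le-\sigma_{-h^{\lambda,\mu}}\|x-y\|^2$$ for some constants $\sigma_{h^{\lambda,\mu}}\ge\frac{-1}{\mu}$ and $\sigma_{-h^{\lambda,\mu}}\ge\frac{-1}{\lambda-\mu}$, and in particular $L_{h^{\lambda,\mu}}\le\max\{\frac1\mu,\frac1{\lambda-\mu}\}$. Moreover, the estimates can be tightened as follows: 1. $\sigma_{h^{\lambda,\mu}}\ge\frac{\sigma_h}{1+(\lambda-\mu)\sigma_h}$ and $L_{h^{\lambda,\mu}}\le\max\Big\{\frac{|\sigma_h|}{1+(\lambda-\mu)\sigma_h},\frac{1}{\lambda-\mu}\Big\}$ if $h$ is $\sigma_h$-hypoconvex;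 2. $\sigma_{-h^{\lambda,\mu}}\ge-\frac{L_h}{1+(\lambda-\mu)L_h}$ and $L_{h^{\lambda,\mu}}\le\frac{L_h}{1+(\lambda-\mu)L_h}$ if $h$ is $L_h$-smooth.
   Context: $\langle\cdot,\cdot\rangle$ and $\|\cdot\|$ are the Euclidean inner product and norm on $\mathbb{R}^n$. A function $h:\mathbb{R}^n\to\mathbb{R}\cup\{+\infty\}$ is proper if it is not identically $+\infty$. It is $\gamma_h$-prox-bounded if $h+\frac{1}{2\gamma}\|\cdot\|^2$ is bounded below on $\mathbb{R}^n$ for some $\gamma>0$, and $\gamma_h\in(0,+\infty]$ is the supremum of all such $\gamma$. For $\lambda>0$ the $\lambda$-Moreau envelope of $h$ is $h^{\lambda}(x):=\inf_w\{h(w)+\frac{1}{2\lambda}\|w-x\|^2\}$. For $\lambda>\mu>0$ the $(\lambda,\mu)$-Lasry--Lions double envelope of $h$ is $$h^{\lambda,\mu}(x):=-(-h^{\lambda})^{\mu}(x)=\sup_w\Big\{h^{\lambda}(w)-\tfrac{1}{2\mu}\|w-x\|^2\Big\}.$$ $f^*$ denotes the Legendre--Fenchel conjugate, $f^*(y)=\sup_x\{\langle x,y\rangle-f(x)\}$. For $t>0$, $\operatorname{prox}_{t f}(y):=\operatorname{argmin}_w\{f(w)+\frac{1}{2t}\|w-y\|^2\}$, which is single-valued when $f$ is proper, lower semicontinuous and convex. $L_{h^{\lambda,\mu}}$ denotes a Lipschitz modulus of $\nabla h^{\lambda,\mu}$, and $\sigma_{h^{\lambda,\mu}},\sigma_{-h^{\lambda,\mu}}\in\mathbb{R}$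 denote constants for which the displayed two-sided inequality holds for all $x,y$; the bounds assert that such constants exist satisfying the stated inequalities. For $\sigma\in\mathbb{R}$, a function $f$ is $\sigma$-hypoconvex if $f-\frac{\sigma}{2}\|\cdot\|^2$ is convex. A function $f$ is $L$-smooth if it is (finite-valued and) differentiable on $\mathbb{R}^n$ with $L$-Lipschitz continuous gradient.
   Formalization: Item 1 is stated for 1+(λ−μ)σ_h>0; in item 2 the bound on L is stated for σ-hypoconvex h with σ≥−L_h/(1+2(λ−μ)L_h), and otherwise as max{1/μ, L_h/(1+(λ−μ)L_h)}; as printed it fails for h=−‖·‖²/2, λ=1/2, μ=1/4. *)

theory Defs
  imports "HOL-Analysis.Analysis"
begin

text \<open>
  Functions \<open>\<real>\<^sup>n \<rightarrow> \<real> \<union> {+\<infinity>}\<close> are rendered as \<open>ereal\<close>-valued functions; the exclusion of the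
  value \<open>-\<infinity>\<close> is part of \<open>proper\<close>.
\<close>

definition proper :: "('a \<Rightarrow> ereal) \<Rightarrow> bool" where
  "proper h \<longleftrightarrow> (\<forall>x. h x \<noteq> -\<infinity>) \<and> (\<exists>x. h x \<noteq> \<infinity>)"

definition lower_semicontinuous :: "('a::topological_space \<Rightarrow> ereal) \<Rightarrow> bool" where
  "lower_semicontinuous h \<longleftrightarrow> (\<forall>x. h x \<le> Liminf (at x) h)"

definition prox_bounds :: "('a::real_normed_vector \<Rightarrow> ereal) \<Rightarrow> real set" where
  "prox_bounds h =
     {\<gamma>. \<gamma> > 0 \<and> (\<exists>m::real. \<forall>x. ereal m \<le> h x + ereal (1 / (2 * \<gamma>) * (norm x)\<^sup>2))}"

definition prox_bounded :: "ereal \<Rightarrow> ('a::real_normed_vector \<Rightarrow> ereal) \<Rightarrow> bool" where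
  "prox_bounded \<gamma>h h \<longleftrightarrow> prox_bounds h \<noteq> {} \<and> \<gamma>h = (SUP \<gamma>\<in>prox_bounds h. ereal \<gamma>)"

definition moreau_env :: "real \<Rightarrow> ('a::real_normed_vector \<Rightarrow> ereal) \<Rightarrow> 'a \<Rightarrow> ereal" where
  "moreau_env lam h x = (INF w. h w + ereal (1 / (2 * lam) * (norm (w - x))\<^sup>2))"

definition lasry_lions_env ::
    "real \<Rightarrow> real \<Rightarrow> ('a::real_normed_vector \<Rightarrow> ereal) \<Rightarrow> 'a \<Rightarrow> ereal" where
  "lasry_lions_env lam mu h x = - moreau_env mu (\<lambda>w. - moreau_env lam h w) x"

definition fenchel_conj :: "('a::real_inner \<Rightarrow> ereal) \<Rightarrow> 'a \<Rightarrow> ereal" where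
  "fenchel_conj f y = (SUP x. ereal (x \<bullet> y) - f x)"

text \<open>The proximal mapping is set-valued; single-valuedness is asserted where it is used.\<close>

definition prox :: "real \<Rightarrow> ('a::real_normed_vector \<Rightarrow> ereal) \<Rightarrow> 'a \<Rightarrow> 'a set" where
  "prox t f y =
     {w. is_arg_min (\<lambda>w. f w + ereal (1 / (2 * t) * (norm (w - y))\<^sup>2)) (\<lambda>_. True) w}"

text \<open>Convexity of an extended-real-valued function is convexity of its epigraph.\<close>

definition ereal_convex :: "('a::real_vector \<Rightarrow> ereal) \<Rightarrow> bool" where
  "ereal_convex f \<longleftrightarrow> convex {(x, r::real). f x \<le> ereal r}"

definition hypoconvex :: "real \<Rightarrow> ('a::real_normed_vector \<Rightarrow> ereal) \<Rightarrow> bool" where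
  "hypoconvex \<sigma> f \<longleftrightarrow> ereal_convex (\<lambda>x. f x - ereal (\<sigma> / 2 * (norm x)\<^sup>2))"

definition has_gradient :: "('a::real_inner \<Rightarrow> ereal) \<Rightarrow> ('a \<Rightarrow> 'a) \<Rightarrow> bool" where
  "has_gradient f g \<longleftrightarrow>
     (\<forall>x. \<bar>f x\<bar> \<noteq> \<infinity>) \<and> (\<forall>x. GDERIV (\<lambda>z. real_of_ereal (f z)) x :> g x)"

definition L_smooth :: "real \<Rightarrow> ('a::real_inner \<Rightarrow> ereal) \<Rightarrow> bool" where
  "L_smooth L f \<longleftrightarrow> (\<exists>g. has_gradient f g \<and> L-lipschitz_on UNIV g)"

definition two_sided_bound :: "real \<Rightarrow> real \<Rightarrow> ('a::real_inner \<Rightarrow> 'a) \<Rightarrow> bool" where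
  "two_sided_bound \<sigma> \<sigma>' g \<longleftrightarrow>
     (\<forall>x y. \<sigma> * (norm (x - y))\<^sup>2 \<le> (g x - g y) \<bullet> (x - y) \<and>
            (g x - g y) \<bullet> (x - y) \<le> - \<sigma>' * (norm (x - y))\<^sup>2)"

text \<open>
  Two estimates of the source need side conditions, which the theorem makes explicit.

  \<^item> The fraction \<open>\<sigma>h / (1 + (lam - mu) \<sigma>h)\<close> is used only where its denominator is positive: \<open>h = 0\<close> is
    \<open>\<sigma>h\<close>-hypoconvex for \<open>\<sigma>h = -1\<close>, with infinite prox-bound, and for \<open>lam - mu = 2\<close> the fraction is \<open>1\<close>,
    although the double envelope is \<open>0\<close>.

  \<^item> The modulus \<open>L / (1 + (lam - mu) L)\<close> for an \<open>L\<close>-smooth \<open>h\<close> fails without a lower curvature bound: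
    \<open>h = - norm\<^sup>2 / 2\<close> is \<open>1\<close>-smooth with prox-bound \<open>1\<close>, and for \<open>lam = 1/2\<close>, \<open>mu = 1/4\<close> the double
    envelope is \<open>- (2/3) norm\<^sup>2\<close>, with modulus \<open>4/3\<close> instead of \<open>4/5\<close>. It is stated for
    \<open>\<sigma>\<close>-hypoconvex \<open>h\<close> with \<open>\<sigma> \<ge> - L / (1 + 2 (lam - mu) L)\<close>, which covers all convex \<open>h\<close> and cannot be
    lowered in general, as \<open>h = (\<sigma> / 2) norm\<^sup>2\<close> shows; for arbitrary \<open>L\<close>-smooth \<open>h\<close> the modulus is bounded by
    the larger of it and \<open>1 / mu\<close>.
\<close>

end

theory Submission
  imports Defs
begin

text \<open>
  Write \<open>d = lam - mu\<close>, \<open>j = norm\<^sup>2 / 2\<close> and \<open>f = h + j / lam\<close>. Expanding the squares turns the first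
  envelope into \<open>j / lam - f\<^sup>*(\<cdot> / lam)\<close>, whatever the shape of \<open>h\<close>. Substituting \<open>w = lam u\<close> in the outer
  supremum and completing the square gives
  \<open>h^{lam,mu}(x) = j(x) / d - e(x / d)\<close>,
  where \<open>e\<close> is the Moreau envelope of the \<^emph>\<open>convex\<close> function \<open>g = f\<^sup>*\<close> with parameter \<open>1 / c\<close>
  (\<open>lasry_lions_env_eq\<close>). A prox-bound above \<open>lam\<close> makes \<open>f\<close> grow quadratically, so \<open>g\<close> is finite
  everywhere, and the proximal points of \<open>g\<close> exist, are unique, and give the gradient of \<open>e\<close>
  (\<open>ex_prox\<close>, \<open>prox_unique\<close>, \<open>env_gradient\<close>); this gives the formula for the gradient \<open>G\<close>.

  All estimates are curvature bounds that travel along \<open>h \<rightarrow> f \<rightarrow> g \<rightarrow> e \<rightarrow> h^{lam,mu}\<close>. Strong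
  convexity of \<open>f\<close> with modulus \<open>\<tau>\<close> bounds the curvature of \<open>g\<close> above by \<open>1 / \<tau>\<close>; an upper curvature
  bound \<open>l\<close> for \<open>f\<close>, convex or not, makes \<open>g\<close> strongly convex with modulus \<open>1 / l\<close>
  (\<open>fenchel_conj_of_strongly_convex\<close>, \<open>fenchel_conj_strongly_convex\<close>). A curvature bound \<open>s\<close> of \<open>g\<close>, from
  above or from below, becomes the bound \<open>s c / (s + c)\<close> for \<open>e\<close> (\<open>env_hypoconvex\<close>,
  \<open>env_neg_hypoconvex\<close>). The bounds \<open>- 1 / mu\<close> and \<open>1 / d\<close> are what remains when nothing is known about
  \<open>h\<close> besides the convexity of \<open>g\<close>.

  One triple of constants has to serve every admissible \<open>\<sigma>h\<close> and \<open>Lh\<close> at once, so \<open>\<sigma>1\<close> and \<open>\<sigma>2\<close> are the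
  largest curvature constants of \<open>h^{lam,mu}\<close> and of \<open>- h^{lam,mu}\<close> (\<open>best_curvature\<close>), and
  \<open>L = max (- \<sigma>1) (- \<sigma>2)\<close>. That this \<open>L\<close> is a Lipschitz modulus is the Baillon--Haddad argument
  (\<open>two_sided_imp_lipschitz\<close>).
\<close>

section \<open>Curvature bounds for real functions\<close>

text \<open>
  The curvature bound is stated on segments instead of as convexity of \<open>F - (a / 2) norm\<^sup>2\<close>: the
  quadratics of envelopes and conjugates then enter through the single identity
  \<open>norm_sq_convex_comb\<close>. Upper curvature bounds are lower bounds for
  \<open>- F\<close>.
\<close>

definition hypoconvex_real :: "real \<Rightarrow> ('a::real_inner \<Rightarrow> real) \<Rightarrow> bool" where
  "hypoconvex_real a F \<longleftrightarrow>
     (\<forall>x y t. 0 \<le> t \<and> t \<le> 1 \<longrightarrow>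
        F ((1 - t) *\<^sub>R x + t *\<^sub>R y)
          \<le> (1 - t) * F x + t * F y - a / 2 * (t * (1 - t)) * (norm (x - y))\<^sup>2)"

lemma hypoconvex_realI:
  assumes "\<And>x y t. 0 < t \<Longrightarrow> t < 1 \<Longrightarrow>
    F ((1 - t) *\<^sub>R x + t *\<^sub>R y)
      \<le> (1 - t) * F x + t * F y - a / 2 * (t * (1 - t)) * (norm (x - y))\<^sup>2"
  shows "hypoconvex_real a F"
  unfolding hypoconvex_real_def
proof (intro allI impI)
  fix x y :: 'a and t :: real
  assume "0 \<le> t \<and> t \<le> 1"
  then consider "t = 0" | "t = 1" | "0 < t" "t < 1" by linarith
  then show "F ((1 - t) *\<^sub>R x + t *\<^sub>R y)
      \<le> (1 - t) * F x + t * F y - a / 2 * (t * (1 - t)) * (norm (x - y))\<^sup>2"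
    by cases (use assms in auto)
qed

lemma hypoconvex_realD:
  assumes "hypoconvex_real a F" "0 \<le> t" "t \<le> 1"
  shows "F ((1 - t) *\<^sub>R x + t *\<^sub>R y)
      \<le> (1 - t) * F x + t * F y - a / 2 * (t * (1 - t)) * (norm (x - y))\<^sup>2"
  using assms unfolding hypoconvex_real_def by blast

lemma hypoconvex_real_mono:
  assumes "hypoconvex_real b F" "a \<le> b"
  shows "hypoconvex_real a F"
proof (rule hypoconvex_realI)
  fix x y :: 'a and t :: real
  assume t: "0 < t" "t < 1"
  have "a / 2 * (t * (1 - t)) * (norm (x - y))\<^sup>2 \<le> b / 2 * (t * (1 - t)) * (norm (x - y))\<^sup>2"
    using t assms(2) by (intro mult_right_mono) auto
  then show "F ((1 - t) *\<^sub>R x + t *\<^sub>R y)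
      \<le> (1 - t) * F x + t * F y - a / 2 * (t * (1 - t)) * (norm (x - y))\<^sup>2"
    using hypoconvex_realD[OF assms(1), of t x y] t by linarith
qed

lemma inner_convex_comb:
  fixes x y u v :: "'a::real_inner"
  shows "((1 - t) *\<^sub>R x + t *\<^sub>R y) \<bullet> ((1 - t) *\<^sub>R u + t *\<^sub>R v)
       = (1 - t) * (x \<bullet> u) + t * (y \<bullet> v) - t * (1 - t) * ((x - y) \<bullet> (u - v))"
  by (simp add: inner_simps algebra_simps)

lemma norm_sq_convex_comb:
  fixes x y :: "'a::real_inner"
  shows "(norm ((1 - t) *\<^sub>R x + t *\<^sub>R y))\<^sup>2
       = (1 - t) * (norm x)\<^sup>2 + t * (norm y)\<^sup>2 - t * (1 - t) * (norm (x - y))\<^sup>2"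
  unfolding power2_norm_eq_inner by (rule inner_convex_comb)

text \<open>
  Dividing the inequality on the segment from \<open>x\<close> to \<open>y\<close> by \<open>t\<close> and letting \<open>t \<rightarrow> 0\<close> gives the tangent
  inequality at \<open>x\<close>; adding the same inequality at \<open>y\<close> cancels the function values.
\<close>

lemma hypoconvex_real_gradient:
  fixes F :: "'a::real_inner \<Rightarrow> real"
  assumes hyp: "hypoconvex_real a F" and der: "\<And>x. GDERIV F x :> G x"
  shows "a * (norm (x - y))\<^sup>2 \<le> (G x - G y) \<bullet> (x - y)"
proof -
  have tangent: "F x + G x \<bullet> (y - x) + a / 2 * (norm (x - y))\<^sup>2 \<le> F y" for x y
  proof -
    let ?p = "\<lambda>t. x + t *\<^sub>R (y - x)"
    have "(F has_derivative (\<lambda>h. h \<bullet> G x)) (at (?p 0))"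
      using der[of x] by (simp add: gderiv_def)
    moreover have "(?p has_derivative (\<lambda>h. h *\<^sub>R (y - x))) (at 0)"
      by (auto intro!: derivative_eq_intros)
    ultimately have "(F \<circ> ?p has_derivative (\<lambda>h. h \<bullet> G x) \<circ> (\<lambda>h. h *\<^sub>R (y - x))) (at 0)"
      by (rule diff_chain_at[rotated])
    then have "((\<lambda>t. F (?p t)) has_real_derivative (G x \<bullet> (y - x))) (at 0)"
      unfolding has_field_derivative_def by (simp add: o_def inner_commute mult.commute mult_commute_abs)
    then have lim: "((\<lambda>t. (F (?p t) - F x) / t) \<longlongrightarrow> G x \<bullet> (y - x)) (at_right 0)"
      unfolding has_field_derivative_iff by (auto intro: tendsto_mono at_le)
    have lim2: "((\<lambda>t. F y - F x - a / 2 * (1 - t) * (norm (x - y))\<^sup>2)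
        \<longlongrightarrow> F y - F x - a / 2 * (1 - 0) * (norm (x - y))\<^sup>2) (at_right 0)"
      by (intro tendsto_intros)
    have "\<forall>\<^sub>F t in at_right (0::real). (F (?p t) - F x) / t
        \<le> F y - F x - a / 2 * (1 - t) * (norm (x - y))\<^sup>2"
      using eventually_at_right_less[of "0::real"] eventually_at_right_real[of 0 1, simplified]
    proof eventually_elim
      case (elim t)
      have "?p t = (1 - t) *\<^sub>R x + t *\<^sub>R y" by (simp add: algebra_simps)
      with hypoconvex_realD[OF hyp, of t x y] elim
      have "F (?p t) - F x \<le> t * (F y - F x - a / 2 * (1 - t) * (norm (x - y))\<^sup>2)"
        by (simp add: algebra_simps)
      then show ?case using elim by (simp add: divide_le_eq mult.commute)
    qed
    from tendsto_le[OF _ lim2 lim this]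
    show ?thesis by simp
  qed
  show ?thesis
    using tangent[of x y] tangent[of y x]
    by (simp add: norm_minus_commute inner_simps)
qed

text \<open>
  Along the segment from \<open>x\<close> to \<open>y\<close>, monotonicity says that \<open>F\<close> minus the model on the left has a
  nonnegative derivative.
\<close>

lemma gradient_lower_tangent:
  fixes F :: "'a::real_inner \<Rightarrow> real"
  assumes der: "\<And>x. GDERIV F x :> G x"
    and mono: "\<And>x y. a * (norm (x - y))\<^sup>2 \<le> (G x - G y) \<bullet> (x - y)"
  shows "F x + G x \<bullet> (y - x) + a / 2 * (norm (y - x))\<^sup>2 \<le> F y"
proof -
  let ?p = "\<lambda>t. x + t *\<^sub>R (y - x)"
  let ?\<phi> = "\<lambda>t. F (?p t) - t * (G x \<bullet> (y - x)) - a / 2 * t\<^sup>2 * (norm (y - x))\<^sup>2"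
  let ?\<phi>' = "\<lambda>t. (G (?p t) - G x) \<bullet> (y - x) - a * t * (norm (y - x))\<^sup>2"
  have d1: "((\<lambda>t. F (?p t)) has_real_derivative (G (?p t) \<bullet> (y - x))) (at t)" for t
  proof -
    have "(F has_derivative (\<lambda>h. h \<bullet> G (?p t))) (at (?p t))"
      using der by (simp add: gderiv_def)
    moreover have "(?p has_derivative (\<lambda>h. h *\<^sub>R (y - x))) (at t)"
      by (auto intro!: derivative_eq_intros)
    ultimately have "(F \<circ> ?p has_derivative (\<lambda>h. h \<bullet> G (?p t)) \<circ> (\<lambda>h. h *\<^sub>R (y - x))) (at t)"
      by (rule diff_chain_at[rotated])
    then show ?thesis
      unfolding has_field_derivative_def by (simp add: o_def inner_commute mult.commute mult_commute_abs)
  qed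
  have d: "(?\<phi> has_real_derivative ?\<phi>' t) (at t)" for t
    by (rule derivative_eq_intros d1 refl)+ (simp add: inner_simps algebra_simps)
  have nonneg: "0 \<le> ?\<phi>' t" if "0 \<le> t" for t
  proof (cases "t = 0")
    case False
    then have "t > 0" using that by simp
    have "a * (norm (t *\<^sub>R (y - x)))\<^sup>2 \<le> (G (?p t) - G x) \<bullet> (t *\<^sub>R (y - x))"
      using mono[of "?p t" x] by simp
    then have "t * (a * t * (norm (y - x))\<^sup>2) \<le> t * ((G (?p t) - G x) \<bullet> (y - x))"
      by (simp only: norm_scaleR power_mult_distrib power2_abs inner_scaleR_right)
        (simp add: power2_eq_square mult_ac)
    then show ?thesis using \<open>t > 0\<close> by simp
  qed simp
  have "?\<phi> 0 \<le> ?\<phi> 1"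
    by (rule DERIV_nonneg_imp_nondecreasing[of 0 1 ?\<phi>]) (use d nonneg in \<open>auto intro!: exI\<close>)
  then show ?thesis by simp
qed

text \<open>
  The two tangent inequalities at the point \<open>z\<close> of the segment, one towards each end, are averaged so
  that the gradient at \<open>z\<close> cancels.
\<close>

lemma gradient_monotone_imp_hypoconvex_real:
  fixes F :: "'a::real_inner \<Rightarrow> real"
  assumes der: "\<And>x. GDERIV F x :> G x"
    and mono: "\<And>x y. a * (norm (x - y))\<^sup>2 \<le> (G x - G y) \<bullet> (x - y)"
  shows "hypoconvex_real a F"
proof (rule hypoconvex_realI)
  fix x y :: 'a and t :: real
  assume t: "0 < t" "t < 1"
  define z where "z = (1 - t) *\<^sub>R x + t *\<^sub>R y"
  have x: "x - z = t *\<^sub>R (x - y)" and y: "y - z = - ((1 - t) *\<^sub>R (x - y))"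
    by (simp_all add: z_def algebra_simps)
  have "F z + t * (G z \<bullet> (x - y)) + a / 2 * t\<^sup>2 * (norm (x - y))\<^sup>2 \<le> F x"
    using gradient_lower_tangent[OF der mono, of z x] by (simp add: x power_mult_distrib)
  then have 1: "(1 - t) * (F z + t * (G z \<bullet> (x - y)) + a / 2 * t\<^sup>2 * (norm (x - y))\<^sup>2)
      \<le> (1 - t) * F x"
    using t by (intro mult_left_mono) auto
  have "F z - (1 - t) * (G z \<bullet> (x - y)) + a / 2 * (1 - t)\<^sup>2 * (norm (x - y))\<^sup>2 \<le> F y"
    using gradient_lower_tangent[OF der mono, of z y] by (simp add: y power_mult_distrib)
  then have 2: "t * (F z - (1 - t) * (G z \<bullet> (x - y)) + a / 2 * (1 - t)\<^sup>2 * (norm (x - y))\<^sup>2)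
      \<le> t * F y"
    using t by (intro mult_left_mono) auto
  have "F z \<le> (1 - t) * F x + t * F y - a / 2 * (t * (1 - t)) * (norm (x - y))\<^sup>2"
    using add_mono[OF 1 2] by (simp add: power2_eq_square field_simps)
  then show "F ((1 - t) *\<^sub>R x + t *\<^sub>R y)
      \<le> (1 - t) * F x + t * F y - a / 2 * (t * (1 - t)) * (norm (x - y))\<^sup>2"
    by (simp add: z_def)
qed

text \<open>
  Baillon--Haddad, in a form that allows curvature of both signs. After subtracting \<open>(a / 2) norm\<^sup>2\<close> the
  curvature lies in \<open>[0, b - a]\<close>, and the gradient difference \<open>D\<close> is cocoercive:
  \<open>(norm D)\<^sup>2 \<le> (b - a) (D \<bullet> (x - y))\<close>. Putting \<open>a (x - y)\<close> back gives
  \<open>max \<bar>a\<bar> \<bar>b\<bar>\<close> as Lipschitz modulus. Cauchy--Schwarz alone would not do: without symmetry of the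
  second derivative, a bound on the symmetric part says nothing about the norm of \<open>G x - G y\<close>.
\<close>

lemma two_sided_imp_lipschitz:
  fixes F :: "'a::real_inner \<Rightarrow> real"
  assumes der: "\<And>x. GDERIV F x :> G x"
    and lower: "\<And>x y. a * (norm (x - y))\<^sup>2 \<le> (G x - G y) \<bullet> (x - y)"
    and upper: "\<And>x y. (G x - G y) \<bullet> (x - y) \<le> b * (norm (x - y))\<^sup>2"
    and ab: "- L \<le> a" "a \<le> b" "b \<le> L"
  shows "L-lipschitz_on UNIV G"
proof -
  define D where "D = (\<lambda>x y. (G x - G y) - a *\<^sub>R (x - y))"
  have mono: "0 \<le> D x y \<bullet> (x - y)" for x y
    using lower[of x y] by (simp add: D_def inner_diff_left power2_norm_eq_inner)
  have tl: "F x + G x \<bullet> (y - x) + a / 2 * (norm (y - x))\<^sup>2 \<le> F y" for x y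
    by (rule gradient_lower_tangent[OF der lower])
  have tu: "F y \<le> F x + G x \<bullet> (y - x) + b / 2 * (norm (y - x))\<^sup>2" for x y
  proof -
    have "- F x + (- G x) \<bullet> (y - x) + (- b) / 2 * (norm (y - x))\<^sup>2 \<le> - F y"
      by (rule gradient_lower_tangent[of "\<lambda>x. - F x" "\<lambda>x. - G x"])
        (use der upper in \<open>auto intro: GDERIV_minus simp: inner_diff_left algebra_simps\<close>)
    then show ?thesis by simp
  qed
  have half: "F x + G x \<bullet> (y - x) + a / 2 * (norm (y - x))\<^sup>2 + 1 / (2 * M) * (norm (D x y))\<^sup>2 \<le> F y"
    if M: "M > 0" "b - a \<le> M" for M x y
  proof -
    \<comment> \<open>The quadratic upper model at \<open>y\<close> is compared with the lower model at \<open>x\<close>,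
      at the point where they are closest if \<open>M = b - a\<close>.\<close>
    define u where "u = (1 / M) *\<^sub>R D x y"
    have MU: "D x y = M *\<^sub>R u" using M by (simp add: u_def)
    have Gy: "G y = G x - M *\<^sub>R u - a *\<^sub>R (x - y)"
      using MU by (simp add: D_def algebra_simps)
    have "F x + G x \<bullet> (y + u - x) + a / 2 * (norm (y + u - x))\<^sup>2 \<le> F (y + u)"
      by (rule tl)
    also have "\<dots> \<le> F y + G y \<bullet> u + b / 2 * (norm u)\<^sup>2"
      using tu[of "y + u" y] by simp
    also have "\<dots> \<le> F y + G y \<bullet> u + (M + a) / 2 * (norm u)\<^sup>2"
      using M by (intro add_left_mono mult_right_mono) auto
    finally have "F x + G x \<bullet> (y - x) + a / 2 * (norm (y - x))\<^sup>2 + M / 2 * (norm u)\<^sup>2 \<le> F y"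
      unfolding Gy power2_norm_eq_inner
      by (simp add: inner_simps algebra_simps inner_commute add_divide_distrib)
    moreover have "1 / (2 * M) * (norm (D x y))\<^sup>2 = M / 2 * (norm u)\<^sup>2"
      using M by (simp add: MU power_mult_distrib power2_eq_square)
    ultimately show ?thesis by simp
  qed
  have sym: "D y x = - D x y" for x y by (simp add: D_def algebra_simps)
  have coco': "(norm (D x y))\<^sup>2 \<le> M * (D x y \<bullet> (x - y))" if M: "M > 0" "b - a \<le> M" for M x y
  proof -
    have "1 / M * (norm (D x y))\<^sup>2 \<le> D x y \<bullet> (x - y)"
      using half[OF M, of x y] half[OF M, of y x]
      by (simp add: sym[of y x] norm_minus_commute power2_norm_eq_inner inner_simps D_def
          algebra_simps inner_commute)
    then show ?thesis using M by (simp add: field_simps)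
  qed
  have coco: "(norm (D x y))\<^sup>2 \<le> (b - a) * (D x y \<bullet> (x - y))" for x y
  \<comment> \<open>For \<open>b = a\<close> the constant \<open>b - a\<close> is not positive; any \<open>M > 0\<close> gives \<open>D = 0\<close> instead.\<close>
  proof (cases "b = a")
    case True
    then have "D x y \<bullet> (x - y) \<le> 0"
      using upper[of x y] by (simp add: D_def inner_diff_left power2_norm_eq_inner)
    then have "D x y \<bullet> (x - y) = 0" using mono[of x y] by simp
    then show ?thesis using coco'[of 1 x y] True by simp
  qed (use coco'[of "b - a" x y] ab in auto)
  have "norm (G x - G y) \<le> L * norm (x - y)" for x y
  proof -
    let ?s = "D x y \<bullet> (x - y)" and ?n = "(norm (x - y))\<^sup>2"
    have s: "0 \<le> ?s" "?s \<le> (b - a) * ?n"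
      using mono[of x y] upper[of x y]
      by (auto simp: D_def inner_diff_left power2_norm_eq_inner left_diff_distrib)
    have "(norm (G x - G y))\<^sup>2 = (norm (D x y))\<^sup>2 + 2 * a * ?s + a\<^sup>2 * ?n"
      unfolding D_def power2_norm_eq_inner
      by (simp add: inner_simps algebra_simps inner_commute power2_eq_square)
    also have "\<dots> \<le> (a + b) * ?s + a\<^sup>2 * ?n"
      using coco[of x y] by (simp add: algebra_simps)
    also have "\<dots> \<le> L\<^sup>2 * ?n"
    proof (cases "a + b \<ge> 0")
      case True
      have "(a + b) * ?s \<le> (a + b) * ((b - a) * ?n)"
        using True s by (intro mult_left_mono) auto
      then have "(a + b) * ?s + a\<^sup>2 * ?n \<le> b\<^sup>2 * ?n"
        by (simp add: power2_eq_square algebra_simps)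
      also have "\<dots> \<le> L\<^sup>2 * ?n"
        using ab True by (intro mult_right_mono power_mono) auto
      finally show ?thesis .
    next
      case False
      then have "(a + b) * ?s \<le> 0" using s by (simp add: mult_nonpos_nonneg)
      moreover have "a\<^sup>2 * ?n \<le> L\<^sup>2 * ?n"
        using ab False by (intro mult_right_mono) (auto intro!: abs_le_square_iff[THEN iffD1])
      ultimately show ?thesis by linarith
    qed
    finally have "(norm (G x - G y))\<^sup>2 \<le> (L * norm (x - y))\<^sup>2" 
      by (simp add: power_mult_distrib)
    then show ?thesis
      using ab by (simp add: power2_le_iff_abs_le)
  qed
  then show ?thesis using ab by (auto simp: lipschitz_on_def dist_norm)
qed

lemma GDERIV_of_quadratic_bound:
  fixes F :: "'a::real_inner \<Rightarrow> real"
  assumes "\<And>y. \<bar>F y - F x - v \<bullet> (y - x)\<bar> \<le> K * (norm (y - x))\<^sup>2"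
  shows "GDERIV F x :> v"
proof -
  have "(F has_derivative (\<lambda>h. h \<bullet> v)) (at x)"
    unfolding has_derivative_at
  proof (intro conjI bounded_linear_inner_left)
    have lim: "((\<lambda>h::'a. K * norm h) \<longlongrightarrow> 0) (at 0)"
      by (rule tendsto_eq_intros refl)+ simp
    show "(\<lambda>h. norm (F (x + h) - F x - h \<bullet> v) / norm h) \<midarrow>0\<rightarrow> 0"
    proof (rule tendsto_sandwich[OF _ _ tendsto_const lim])
      show "\<forall>\<^sub>F h in at 0. norm (F (x + h) - F x - h \<bullet> v) / norm h \<le> K * norm h"
        unfolding eventually_at_filter
      proof (intro always_eventually allI impI)
        fix h :: 'a assume "h \<noteq> 0"
        then show "norm (F (x + h) - F x - h \<bullet> v) / norm h \<le> K * norm h"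
          using assms[of "x + h"]
          by (simp add: divide_le_eq inner_commute power2_eq_square mult.assoc)
      qed
    qed (auto intro!: always_eventually)
  qed
  then show ?thesis by (simp add: gderiv_def)
qed

section \<open>Proximal points and Moreau envelopes of convex functions\<close>

text \<open>
  Proximal points with parameter \<open>1 / c\<close>, in terms of the real weight \<open>c / 2\<close> of the square.
\<close>

definition is_prox :: "real \<Rightarrow> ('a::real_inner \<Rightarrow> real) \<Rightarrow> 'a \<Rightarrow> 'a \<Rightarrow> bool" where
  "is_prox c g y p \<longleftrightarrow>
     (\<forall>v. g p + c / 2 * (norm (p - y))\<^sup>2 \<le> g v + c / 2 * (norm (v - y))\<^sup>2)"

text \<open>
  When \<open>P\<close> selects proximal points, this is the Moreau envelope of \<open>g\<close> with parameter \<open>1 / c\<close>. Naming the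
  selection makes every envelope inequality an evaluation at a trial point.
\<close>

definition env_via :: "real \<Rightarrow> ('a::real_inner \<Rightarrow> real) \<Rightarrow> ('a \<Rightarrow> 'a) \<Rightarrow> 'a \<Rightarrow> real" where
  "env_via c g P y = g (P y) + c / 2 * (norm (P y - y))\<^sup>2"

lemma env_via_le:
  "is_prox c g y (P y) \<Longrightarrow> env_via c g P y \<le> g v + c / 2 * (norm (v - y))\<^sup>2"
  by (simp add: is_prox_def env_via_def)

lemma prox_ereal_eq:
  assumes "c > 0"
  shows "prox (inverse c) (\<lambda>w. ereal (g w)) y = {w. is_prox c g y w}"
proof -
  have "1 / (2 * inverse c) = c / 2" using assms by (simp add: field_simps)
  then show ?thesis
    unfolding prox_def is_prox_def is_arg_min_def by (simp only:) (auto simp: not_less)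
qed

lemma hypoconvex_real_zero_imp_continuous:
  fixes g :: "'a::euclidean_space \<Rightarrow> real"
  assumes "hypoconvex_real 0 g"
  shows "continuous_on UNIV g"
proof (rule convex_on_continuous)
  show "convex_on UNIV g"
    by (rule convex_onI) (use hypoconvex_realD[OF assms] in auto)
qed auto

text \<open>
  The affine minorant is eventually dominated by the square, so a minimizer over a large ball is a
  global one; on the ball, the finite convex function \<open>g\<close> is continuous.
\<close>

lemma ex_prox:
  fixes g :: "'a::euclidean_space \<Rightarrow> real"
  assumes conv: "hypoconvex_real 0 g" and c: "c > 0" and minor: "\<And>w. a \<bullet> w - r \<le> g w"
  obtains p where "is_prox c g y p"
proof -
  define \<psi> where "\<psi> = (\<lambda>w. g w + c / 2 * (norm (w - y))\<^sup>2)"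
  define A where "A = \<psi> y - a \<bullet> y + r"
  define R where "R = max \<bar>A\<bar> (2 * (norm a + 1) / c)"
  have R: "R \<ge> 0" "A \<le> R" "2 * (norm a + 1) / c \<le> R"
    by (auto simp: R_def)
  have "continuous_on (cball y R) \<psi>"
    unfolding \<psi>_def using hypoconvex_real_zero_imp_continuous[OF conv]
    by (auto intro!: continuous_intros intro: continuous_on_subset)
  then obtain p where p: "p \<in> cball y R" "\<And>v. v \<in> cball y R \<Longrightarrow> \<psi> p \<le> \<psi> v"
    using continuous_attains_inf[of "cball y R" \<psi>] R by auto
  have "\<psi> p \<le> \<psi> v" for v
  proof (cases "v \<in> cball y R")
    case False
    define t where "t = norm (v - y)"
    have t: "t > R" using False by (simp add: t_def dist_norm norm_minus_commute)
    have "- (norm a * t) \<le> a \<bullet> (v - y)"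
      using Cauchy_Schwarz_ineq2[of a "v - y"] by (simp add: t_def)
    then have "a \<bullet> y - norm a * t - r \<le> g v"
      using minor[of v] by (simp add: inner_diff_right)
    moreover have "(norm a + 1) * t \<le> c / 2 * t\<^sup>2"
    proof -
      have "2 * (norm a + 1) / c \<le> t" using R(3) t by simp
      then have "norm a + 1 \<le> c / 2 * t"
        using c by (simp add: divide_le_eq mult.commute)
      then show ?thesis
        using t R(1) by (simp add: power2_eq_square mult_right_mono flip: mult.assoc)
    qed
    ultimately have "a \<bullet> y - r + t \<le> \<psi> v"
      by (simp add: \<psi>_def t_def algebra_simps)
    then have "\<psi> y \<le> \<psi> v" using t R(2) by (simp add: A_def)
    moreover have "\<psi> p \<le> \<psi> y" using p(2)[of y] R(1) by simp
    ultimately show ?thesis by simp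
  qed (use p in auto)
  then show ?thesis by (intro that[of p]) (simp add: is_prox_def \<psi>_def)
qed

text \<open>
  Two minimizers would both be beaten by their midpoint, by the strong convexity of the square.
\<close>

lemma prox_unique:
  fixes g :: "'a::real_inner \<Rightarrow> real"
  assumes conv: "hypoconvex_real 0 g" and c: "c > 0" and "is_prox c g y p" "is_prox c g y q"
  shows "p = q"
proof -
  let ?m = "(1 - 1 / 2) *\<^sub>R p + (1 / 2) *\<^sub>R q"
  have "g ?m \<le> g p / 2 + g q / 2"
    using hypoconvex_realD[OF conv, of "1 / 2" p q] by simp
  moreover have "?m - y = (1 - 1 / 2) *\<^sub>R (p - y) + (1 / 2) *\<^sub>R (q - y)"
    by (simp add: algebra_simps flip: scaleR_add_left)
  then have n: "(norm (?m - y))\<^sup>2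
      = (norm (p - y))\<^sup>2 / 2 + (norm (q - y))\<^sup>2 / 2 - (norm (p - q))\<^sup>2 / 4"
    using norm_sq_convex_comb[of "1 / 2" "p - y" "q - y"] by simp
  moreover have "g p + c / 2 * (norm (p - y))\<^sup>2 \<le> g ?m + c / 2 * (norm (?m - y))\<^sup>2"
    "g q + c / 2 * (norm (q - y))\<^sup>2 \<le> g ?m + c / 2 * (norm (?m - y))\<^sup>2"
    using assms(3,4) unfolding is_prox_def by blast+
  note this[unfolded n]
  ultimately have "c * (norm (p - q))\<^sup>2 \<le> 0"
    by (simp add: algebra_simps)
  then show ?thesis using c by (simp add: mult_le_0_iff)
qed

text \<open>
  The convex combination of the two proximal points is the trial point. The curvature left is
  \<open>s \<bar>A\<bar>\<^sup>2 + c \<bar>A - B\<bar>\<^sup>2\<close> with \<open>A\<close> and \<open>B\<close> the differences of the proximal points and of the arguments;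
  minimizing over \<open>A\<close> gives the factor \<open>s c / (s + c)\<close>, half the harmonic mean of \<open>s\<close> and \<open>c\<close>.
\<close>

lemma env_hypoconvex:
  fixes g :: "'a::real_inner \<Rightarrow> real"
  assumes g: "hypoconvex_real s g" and s: "s \<ge> 0" and c: "c > 0"
    and P: "\<And>y. is_prox c g y (P y)"
  shows "hypoconvex_real (s * c / (s + c)) (env_via c g P)"
proof (rule hypoconvex_realI)
  fix x y :: 'a and t :: real
  assume t: "0 < t" "t < 1"
  let ?p = "(1 - t) *\<^sub>R P x + t *\<^sub>R P y" and ?z = "(1 - t) *\<^sub>R x + t *\<^sub>R y"
  define A where "A = P x - P y"
  define B where "B = x - y"
  define T where "T = t * (1 - t)"
  have "?p - ?z = (1 - t) *\<^sub>R (P x - x) + t *\<^sub>R (P y - y)" by (simp add: algebra_simps)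
  moreover have "P x - x - (P y - y) = A - B" by (simp add: A_def B_def)
  ultimately have n: "(norm (?p - ?z))\<^sup>2 = (1 - t) * (norm (P x - x))\<^sup>2 + t * (norm (P y - y))\<^sup>2
      - T * (norm (A - B))\<^sup>2"
    by (simp add: norm_sq_convex_comb T_def)
  have "0 \<le> (norm ((s + c) *\<^sub>R A - c *\<^sub>R B))\<^sup>2" by simp
  also have "\<dots> = (s + c) * (s * (norm A)\<^sup>2 + c * (norm (A - B))\<^sup>2) - s * c * (norm B)\<^sup>2"
    unfolding power2_norm_eq_inner by (simp add: inner_simps inner_commute algebra_simps)
  finally have q: "s * c / (s + c) * (norm B)\<^sup>2 \<le> s * (norm A)\<^sup>2 + c * (norm (A - B))\<^sup>2"
    using s c by (simp add: divide_le_eq mult.commute)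
  have q: "T / 2 * (s * c / (s + c) * (norm B)\<^sup>2)
      \<le> T / 2 * (s * (norm A)\<^sup>2 + c * (norm (A - B))\<^sup>2)"
    using t by (intro mult_left_mono q) (auto simp: T_def)
  have "env_via c g P ?z \<le> g ?p + c / 2 * (norm (?p - ?z))\<^sup>2"
    by (rule env_via_le[OF P])
  also have "\<dots> \<le> (1 - t) * g (P x) + t * g (P y) - s / 2 * T * (norm A)\<^sup>2
      + c / 2 * (norm (?p - ?z))\<^sup>2"
    using hypoconvex_realD[OF g, of t "P x" "P y"] t by (simp add: T_def A_def)
  also have "\<dots> = (1 - t) * env_via c g P x + t * env_via c g P y
      - T / 2 * (s * (norm A)\<^sup>2 + c * (norm (A - B))\<^sup>2)"
    unfolding n env_via_def by (simp add: field_simps)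
  finally show "env_via c g P ?z \<le> (1 - t) * env_via c g P x + t * env_via c g P y
      - s * c / (s + c) / 2 * (t * (1 - t)) * (norm (x - y))\<^sup>2"
    using q by (simp add: T_def B_def mult_ac)
qed

text \<open>
  Here the proximal point \<open>p\<close> of the intermediate point \<open>z\<close> is given, and trial points for \<open>x\<close> and \<open>y\<close>
  are chosen by moving \<open>p\<close> by the fraction \<open>\<theta>\<close> of the move from \<open>z\<close>. The price
  \<open>\<alpha> \<theta>\<^sup>2 + c (1 - \<theta>)\<^sup>2\<close> is least for \<open>\<theta> = c / (\<alpha> + c)\<close>, where it equals \<open>\<alpha> c / (\<alpha> + c)\<close>.
\<close>

lemma env_neg_hypoconvex:
  fixes g :: "'a::real_inner \<Rightarrow> real"
  assumes g: "hypoconvex_real (- \<alpha>) (\<lambda>y. - g y)" and \<alpha>: "\<alpha> > 0" and c: "c > 0"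
    and P: "\<And>y. is_prox c g y (P y)"
  shows "hypoconvex_real (- (\<alpha> * c / (\<alpha> + c))) (\<lambda>y. - env_via c g P y)"
proof (rule hypoconvex_realI)
  fix x y :: 'a and t :: real
  assume t: "0 < t" "t < 1"
  define z where "z = (1 - t) *\<^sub>R x + t *\<^sub>R y"
  define p where "p = P z"
  define \<theta> where "\<theta> = c / (\<alpha> + c)"
  define x' where "x' = p + \<theta> *\<^sub>R (x - z)"
  define y' where "y' = p + \<theta> *\<^sub>R (y - z)"
  define T where "T = t * (1 - t)"
  define N where "N = (norm (x - y))\<^sup>2"
  have "\<theta> * (\<alpha> + c) = c" using \<alpha> c by (simp add: \<theta>_def)
  then have "\<alpha> * \<theta> = c * (1 - \<theta>)" by (simp add: algebra_simps)
  then have "\<alpha> * \<theta>\<^sup>2 + c * (1 - \<theta>)\<^sup>2 = \<alpha> * \<theta>" 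
    by (simp add: power2_eq_square flip: mult.assoc) (simp add: algebra_simps)
  then have \<kappa>: "\<alpha> * \<theta>\<^sup>2 + c * (1 - \<theta>)\<^sup>2 = \<alpha> * c / (\<alpha> + c)" by (simp add: \<theta>_def)
  have "(1 - t) *\<^sub>R (x - z) + t *\<^sub>R (y - z) = 0"
    by (simp add: z_def algebra_simps)
  moreover have "(1 - t) *\<^sub>R x' + t *\<^sub>R y'
      = p + \<theta> *\<^sub>R ((1 - t) *\<^sub>R (x - z) + t *\<^sub>R (y - z))"
    by (simp add: x'_def y'_def algebra_simps)
  ultimately have mid: "(1 - t) *\<^sub>R x' + t *\<^sub>R y' = p" by simp
  have d: "x' - y' = \<theta> *\<^sub>R (x - y)" by (simp add: x'_def y'_def algebra_simps)
  have gp: "(1 - t) * g x' + t * g y' \<le> g p + \<alpha> / 2 * T * (\<theta>\<^sup>2 * N)"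
    using hypoconvex_realD[OF g, of t x' y'] t
    by (simp add: mid d T_def N_def power_mult_distrib)
  have "p - z = (1 - t) *\<^sub>R (x' - x) + t *\<^sub>R (y' - y)"
    using mid by (simp add: z_def algebra_simps)
  moreover have "x' - x - (y' - y) = - ((1 - \<theta>) *\<^sub>R (x - y))"
    using d by (simp add: algebra_simps)
  ultimately have n: "(norm (p - z))\<^sup>2
      = (1 - t) * (norm (x' - x))\<^sup>2 + t * (norm (y' - y))\<^sup>2 - T * ((1 - \<theta>)\<^sup>2 * N)"
    by (simp add: norm_sq_convex_comb T_def N_def power_mult_distrib)
  have "(1 - t) * env_via c g P x + t * env_via c g P y
      \<le> (1 - t) * (g x' + c / 2 * (norm (x' - x))\<^sup>2) + t * (g y' + c / 2 * (norm (y' - y))\<^sup>2)"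
    using t by (intro add_mono mult_left_mono env_via_le P) auto
  also have "\<dots> \<le> g p + \<alpha> / 2 * T * (\<theta>\<^sup>2 * N) 
      + c / 2 * ((1 - t) * (norm (x' - x))\<^sup>2 + t * (norm (y' - y))\<^sup>2)"
    using gp by (simp add: field_simps)
  also have "\<dots> = env_via c g P z + (\<alpha> * \<theta>\<^sup>2 + c * (1 - \<theta>)\<^sup>2) / 2 * T * N"
    unfolding env_via_def p_def[symmetric] n by (simp add: field_simps)
  finally have "(1 - t) * env_via c g P x + t * env_via c g P y
      \<le> env_via c g P z + \<alpha> * c / (\<alpha> + c) / 2 * T * N" unfolding \<kappa> .
  then show "- env_via c g P ((1 - t) *\<^sub>R x + t *\<^sub>R y)
      \<le> (1 - t) * - env_via c g P x + t * - env_via c g P y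
        - - (\<alpha> * c / (\<alpha> + c)) / 2 * (t * (1 - t)) * (norm (x - y))\<^sup>2"
    by (simp add: z_def T_def N_def)
qed

text \<open>
  For fixed \<open>v\<close> the function \<open>g v + (c / 2) \<bar>v - y\<bar>\<^sup>2\<close> has curvature \<open>c\<close> in \<open>y\<close>, and an infimum of such
  functions has curvature at most \<open>c\<close>.
\<close>

lemma env_neg_hypoconvex_parameter:
  fixes g :: "'a::real_inner \<Rightarrow> real"
  assumes P: "\<And>y. is_prox c g y (P y)"
  shows "hypoconvex_real (- c) (\<lambda>y. - env_via c g P y)"
proof (rule hypoconvex_realI)
  fix x y :: 'a and t :: real
  assume t: "0 < t" "t < 1"
  define z where "z = (1 - t) *\<^sub>R x + t *\<^sub>R y"
  have "P z - z = (1 - t) *\<^sub>R (P z - x) + t *\<^sub>R (P z - y)" by (simp add: z_def algebra_simps)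
  then have n: "(norm (P z - z))\<^sup>2 = (1 - t) * (norm (P z - x))\<^sup>2 + t * (norm (P z - y))\<^sup>2
      - t * (1 - t) * (norm (x - y))\<^sup>2"
    by (simp add: norm_sq_convex_comb norm_minus_commute)
  have "(1 - t) * env_via c g P x + t * env_via c g P y
      \<le> (1 - t) * (g (P z) + c / 2 * (norm (P z - x))\<^sup>2)
        + t * (g (P z) + c / 2 * (norm (P z - y))\<^sup>2)"
    using t by (intro add_mono mult_left_mono env_via_le P) auto
  also have "\<dots> = env_via c g P z + c / 2 * (t * (1 - t)) * (norm (x - y))\<^sup>2"
    unfolding env_via_def n by (simp add: field_simps)
  finally show "- env_via c g P ((1 - t) *\<^sub>R x + t *\<^sub>R y)
      \<le> (1 - t) * - env_via c g P x + t * - env_via c g P y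
        - - c / 2 * (t * (1 - t)) * (norm (x - y))\<^sup>2"
    by (simp add: z_def)
qed

text \<open>
  The trial point \<open>P y\<close> gives the upper quadratic model on both sides of \<open>y\<close>; convexity of the envelope
  reflects the one at \<open>y - (v - y)\<close> into a lower model at \<open>v\<close>.
\<close>

lemma env_gradient:
  fixes g :: "'a::real_inner \<Rightarrow> real"
  assumes g: "hypoconvex_real 0 g" and c: "c > 0" and P: "\<And>y. is_prox c g y (P y)"
  shows "GDERIV (env_via c g P) y :> c *\<^sub>R (y - P y)"
proof (rule GDERIV_of_quadratic_bound)
  fix v
  let ?e = "env_via c g P"
  have upper: "?e (y + h) \<le> ?e y + c *\<^sub>R (y - P y) \<bullet> h + c / 2 * (norm h)\<^sup>2" for h
  proof -
    have "?e (y + h) \<le> g (P y) + c / 2 * (norm (P y - (y + h)))\<^sup>2"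
      by (rule env_via_le[OF P])
    also have "\<dots> = ?e y + c *\<^sub>R (y - P y) \<bullet> h + c / 2 * (norm h)\<^sup>2"
      unfolding env_via_def power2_norm_eq_inner
      by (simp add: inner_simps inner_commute field_simps)
    finally show ?thesis .
  qed
  have "hypoconvex_real 0 ?e"
    using env_hypoconvex[OF g _ c P] by simp
  from hypoconvex_realD[OF this, of "1 / 2" "y + (v - y)" "y - (v - y)"]
  have mid: "2 * ?e y \<le> ?e (y + (v - y)) + ?e (y + - (v - y))"
    by (simp add: algebra_simps flip: scaleR_add_left)
  have "?e v - ?e y - c *\<^sub>R (y - P y) \<bullet> (v - y) \<le> c / 2 * (norm (v - y))\<^sup>2"
    using upper[of "v - y"] by simp
  moreover have "- (c / 2 * (norm (v - y))\<^sup>2) \<le> ?e v - ?e y - c *\<^sub>R (y - P y) \<bullet> (v - y)"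
    using upper[of "- (v - y)"] mid unfolding norm_minus_cancel inner_minus_right by simp
  ultimately show "\<bar>?e v - ?e y - c *\<^sub>R (y - P y) \<bullet> (v - y)\<bar> \<le> c / 2 * (norm (v - y))\<^sup>2"
    by linarith
qed

lemma hypoconvex_real_scale_add_quadratic:
  fixes \<phi> :: "'a::real_inner \<Rightarrow> real"
  assumes "hypoconvex_real \<kappa> \<phi>"
  shows "hypoconvex_real (\<kappa> * r\<^sup>2 + b) (\<lambda>x. \<phi> (r *\<^sub>R x) + b / 2 * (norm x)\<^sup>2)"
proof (rule hypoconvex_realI)
  fix x y :: 'a and t :: real
  assume t: "0 < t" "t < 1"
  have e: "r *\<^sub>R ((1 - t) *\<^sub>R x + t *\<^sub>R y) = (1 - t) *\<^sub>R (r *\<^sub>R x) + t *\<^sub>R (r *\<^sub>R y)"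
    by (simp add: algebra_simps)
  have "\<phi> (r *\<^sub>R ((1 - t) *\<^sub>R x + t *\<^sub>R y))
      \<le> (1 - t) * \<phi> (r *\<^sub>R x) + t * \<phi> (r *\<^sub>R y)
        - \<kappa> / 2 * (t * (1 - t)) * (r\<^sup>2 * (norm (x - y))\<^sup>2)"
    unfolding e using hypoconvex_realD[OF assms, of t "r *\<^sub>R x" "r *\<^sub>R y"] t
    by (simp add: power_mult_distrib flip: scaleR_diff_right)
  then show "\<phi> (r *\<^sub>R ((1 - t) *\<^sub>R x + t *\<^sub>R y)) + b / 2 * (norm ((1 - t) *\<^sub>R x + t *\<^sub>R y))\<^sup>2
      \<le> (1 - t) * (\<phi> (r *\<^sub>R x) + b / 2 * (norm x)\<^sup>2) + t * (\<phi> (r *\<^sub>R y) + b / 2 * (norm y)\<^sup>2)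
        - (\<kappa> * r\<^sup>2 + b) / 2 * (t * (1 - t)) * (norm (x - y))\<^sup>2"
    unfolding norm_sq_convex_comb by (simp add: field_simps)
qed

section \<open>Conjugates of supercoercive functions\<close>

lemma fenchel_conj_finite:
  fixes f :: "'a::real_inner \<Rightarrow> ereal"
  assumes "proper f" and \<epsilon>: "\<epsilon> > 0" and lower: "\<And>z. ereal (m + \<epsilon> * (norm z)\<^sup>2) \<le> f z"
  shows "\<bar>fenchel_conj f y\<bar> \<noteq> \<infinity>"
proof -
  obtain x where "f x \<noteq> \<infinity>" "f x \<noteq> -\<infinity>" using assms(1) by (auto simp: proper_def)
  then obtain r where r: "f x = ereal r" by (cases "f x") auto
  have "ereal (x \<bullet> y - r) \<le> fenchel_conj f y"
    unfolding fenchel_conj_def by (rule SUP_upper2[of x]) (auto simp: r)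
  moreover have "fenchel_conj f y \<le> ereal ((norm y)\<^sup>2 / (4 * \<epsilon>) - m)"
    unfolding fenchel_conj_def
  proof (rule SUP_least)
    fix z
    have "0 \<le> (norm ((2 * \<epsilon>) *\<^sub>R z - y))\<^sup>2" by simp
    also have "\<dots> = 4 * \<epsilon> * (\<epsilon> * (norm z)\<^sup>2 - z \<bullet> y) + (norm y)\<^sup>2"
      unfolding power2_norm_eq_inner by (simp add: inner_simps inner_commute algebra_simps)
    finally have q: "z \<bullet> y \<le> (norm y)\<^sup>2 / (4 * \<epsilon>) + \<epsilon> * (norm z)\<^sup>2"
      using \<epsilon> by (simp add: field_simps)
    show "ereal (z \<bullet> y) - f z \<le> ereal ((norm y)\<^sup>2 / (4 * \<epsilon>) - m)"
      using lower[of z] q by (cases "f z") auto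
  qed
  ultimately show ?thesis by (cases "fenchel_conj f y") auto
qed

lemma fenchel_conj_ge:
  assumes "fenchel_conj f y = ereal (g y)" "f x \<le> ereal r"
  shows "x \<bullet> y - r \<le> g y"
proof -
  have "ereal (x \<bullet> y - r) \<le> ereal (x \<bullet> y) - f x"
    using assms(2) by (cases "f x") auto
  also have "\<dots> \<le> ereal (g y)"
    unfolding assms(1)[symmetric] fenchel_conj_def by (rule SUP_upper) simp
  finally show ?thesis by simp
qed

lemma fenchel_conj_le:
  assumes "fenchel_conj f y = ereal (g y)" "proper f"
    and "\<And>x r. f x = ereal r \<Longrightarrow> x \<bullet> y - r \<le> B"
  shows "g y \<le> B"
proof -
  have "fenchel_conj f y \<le> ereal B"
    unfolding fenchel_conj_def
  proof (rule SUP_least)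
    fix x
    show "ereal (x \<bullet> y) - f x \<le> ereal B"
      using assms(2) assms(3)[of x] by (cases "f x") (auto simp: proper_def)
  qed
  then show ?thesis using assms(1) by simp
qed

lemma fenchel_conj_convex:
  fixes f :: "'a::real_inner \<Rightarrow> ereal"
  assumes g: "\<And>y. fenchel_conj f y = ereal (g y)" and f: "proper f"
  shows "hypoconvex_real 0 g"
proof (rule hypoconvex_realI)
  fix y1 y2 :: 'a and t :: real
  assume t: "0 < t" "t < 1"
  have "g ((1 - t) *\<^sub>R y1 + t *\<^sub>R y2) \<le> (1 - t) * g y1 + t * g y2"
  proof (rule fenchel_conj_le[of f _ g, OF g f])
    fix x r assume "f x = ereal r"
    then have "x \<bullet> y - r \<le> g y" for y
      by (intro fenchel_conj_ge[where f = f and g = g, OF g]) simp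
    then have "(1 - t) * (x \<bullet> y1 - r) + t * (x \<bullet> y2 - r) \<le> (1 - t) * g y1 + t * g y2"
      using t by (intro add_mono mult_left_mono) auto
    then show "x \<bullet> ((1 - t) *\<^sub>R y1 + t *\<^sub>R y2) - r \<le> (1 - t) * g y1 + t * g y2"
      by (simp add: inner_simps algebra_simps)
  qed
  then show "g ((1 - t) *\<^sub>R y1 + t *\<^sub>R y2)
      \<le> (1 - t) * g y1 + t * g y2 - 0 / 2 * (t * (1 - t)) * (norm (y1 - y2))\<^sup>2" by simp
qed

lemma hypoconvexD:
  fixes f :: "'a::real_inner \<Rightarrow> ereal"
  assumes "hypoconvex \<tau> f" "f x = ereal r" "f y = ereal s" "0 \<le> t" "t \<le> 1"
  shows "f ((1 - t) *\<^sub>R x + t *\<^sub>R y)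
      \<le> ereal ((1 - t) * r + t * s - \<tau> / 2 * (t * (1 - t)) * (norm (x - y))\<^sup>2)"
proof -
  let ?q = "\<lambda>z. \<tau> / 2 * (norm z)\<^sup>2"
  let ?z = "(1 - t) *\<^sub>R x + t *\<^sub>R y"
  let ?S = "{(x, r::real). f x - ereal (?q x) \<le> ereal r}"
  have "convex ?S" using assms(1) by (simp add: hypoconvex_def ereal_convex_def)
  moreover have "(x, r - ?q x) \<in> ?S" "(y, s - ?q y) \<in> ?S" using assms by auto
  ultimately have "(1 - t) *\<^sub>R (x, r - ?q x) + t *\<^sub>R (y, s - ?q y) \<in> ?S"
    using assms by (intro convexD) auto
  then have "f ?z - ereal (?q ?z) \<le> ereal ((1 - t) * (r - ?q x) + t * (s - ?q y))"
    by simp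
  then have "f ?z \<le> ereal ((1 - t) * (r - ?q x) + t * (s - ?q y) + ?q ?z)"
    by (cases "f ?z") auto
  also have "(1 - t) * (r - ?q x) + t * (s - ?q y) + ?q ?z
      = (1 - t) * r + t * s - \<tau> / 2 * (t * (1 - t)) * (norm (x - y))\<^sup>2"
    unfolding norm_sq_convex_comb by (simp add: field_simps)
  finally show ?thesis .
qed

text \<open>
  For points \<open>x1\<close>, \<open>x2\<close> competing in the suprema \<open>g y1\<close> and \<open>g y2\<close>, their convex combination competes in
  \<open>g\<close> at the intermediate point, and what is lost,
  \<open>(x1 - x2) \<bullet> (y1 - y2) - (\<tau> / 2) \<bar>x1 - x2\<bar>\<^sup>2\<close>, is at most \<open>\<bar>y1 - y2\<bar>\<^sup>2 / (2 \<tau>)\<close>. The suprema are then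
  taken one after the other.
\<close>

lemma fenchel_conj_of_strongly_convex:
  fixes f :: "'a::real_inner \<Rightarrow> ereal"
  assumes g: "\<And>y. fenchel_conj f y = ereal (g y)" and f: "proper f"
    and hyp: "hypoconvex \<tau> f" and \<tau>: "\<tau> > 0"
  shows "hypoconvex_real (- (1 / \<tau>)) (\<lambda>y. - g y)"
proof (rule hypoconvex_realI)
  fix y1 y2 :: 'a and t :: real
  assume t: "0 < t" "t < 1"
  define z where "z = (1 - t) *\<^sub>R y1 + t *\<^sub>R y2"
  define B where "B = g z + 1 / \<tau> / 2 * (t * (1 - t)) * (norm (y1 - y2))\<^sup>2"
  have pair: "(1 - t) * (x1 \<bullet> y1 - r1) + t * (x2 \<bullet> y2 - r2) \<le> B"
    if r: "f x1 = ereal r1" "f x2 = ereal r2" for x1 x2 r1 r2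
  proof -
    let ?x = "(1 - t) *\<^sub>R x1 + t *\<^sub>R x2"
    let ?X = "x1 - x2" and ?Y = "y1 - y2"
    have "?x \<bullet> z - ((1 - t) * r1 + t * r2 - \<tau> / 2 * (t * (1 - t)) * (norm ?X)\<^sup>2) \<le> g z"
      using t by (intro fenchel_conj_ge[of f z g, OF g] hypoconvexD[OF hyp r]) auto
    then have 1: "(1 - t) * (x1 \<bullet> y1 - r1) + t * (x2 \<bullet> y2 - r2)
        + t * (1 - t) * (\<tau> / 2 * (norm ?X)\<^sup>2 - ?X \<bullet> ?Y) \<le> g z"
      unfolding z_def inner_convex_comb by (simp add: algebra_simps)
    have "0 \<le> (norm (\<tau> *\<^sub>R ?X - ?Y))\<^sup>2" by simp
    also have "\<dots> = \<tau> * (2 * (\<tau> / 2 * (norm ?X)\<^sup>2 - ?X \<bullet> ?Y)) + (norm ?Y)\<^sup>2"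
      unfolding power2_norm_eq_inner
      by (simp add: inner_diff_left inner_diff_right inner_commute algebra_simps)
    finally have "- (1 / \<tau> / 2 * (norm ?Y)\<^sup>2) \<le> \<tau> / 2 * (norm ?X)\<^sup>2 - ?X \<bullet> ?Y"
      using \<tau> by (simp add: field_simps)
    then have "t * (1 - t) * - (1 / \<tau> / 2 * (norm ?Y)\<^sup>2)
        \<le> t * (1 - t) * (\<tau> / 2 * (norm ?X)\<^sup>2 - ?X \<bullet> ?Y)"
      using t by (intro mult_left_mono) auto
    then show ?thesis using 1 by (simp add: B_def mult_ac)
  qed
  \<comment> \<open>The supremum over \<open>x1\<close>, with \<open>x2\<close> still fixed; the one over \<open>x2\<close> follows.\<close>
  have first: "(1 - t) * g y1 + t * (x2 \<bullet> y2 - r2) \<le> B" if "f x2 = ereal r2" for x2 r2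
  proof -
    have "g y1 \<le> (B - t * (x2 \<bullet> y2 - r2)) / (1 - t)"
    proof (rule fenchel_conj_le[of f _ g, OF g f])
      fix x1 r1 assume "f x1 = ereal r1"
      from pair[OF this that] show "x1 \<bullet> y1 - r1 \<le> (B - t * (x2 \<bullet> y2 - r2)) / (1 - t)"
        using t by (simp add: pos_le_divide_eq mult.commute)
    qed
    then show ?thesis using t by (simp add: pos_le_divide_eq mult.commute)
  qed
  have "g y2 \<le> (B - (1 - t) * g y1) / t"
  proof (rule fenchel_conj_le[of f _ g, OF g f])
    fix x2 r2 assume "f x2 = ereal r2"
    from first[OF this] show "x2 \<bullet> y2 - r2 \<le> (B - (1 - t) * g y1) / t"
      using t by (simp add: pos_le_divide_eq mult.commute)
  qed
  then have "(1 - t) * g y1 + t * g y2 \<le> B"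
    using t by (simp add: pos_le_divide_eq mult.commute)
  then show "- g ((1 - t) *\<^sub>R y1 + t *\<^sub>R y2)
      \<le> (1 - t) * - g y1 + t * - g y2
        - - (1 / \<tau>) / 2 * (t * (1 - t)) * (norm (y1 - y2))\<^sup>2"
    by (simp add: B_def z_def)
qed

text \<open>
  With \<open>k = (l / 2) norm\<^sup>2 - f\<close> convex, substituting \<open>x = y / l + u\<close> turns \<open>g y - \<bar>y\<bar>\<^sup>2 / (2 l)\<close> into
  the supremum over \<open>u\<close> of \<open>k (y / l + u) - (l / 2) \<bar>u\<bar>\<^sup>2\<close>, hence into a supremum of convex functions of
  \<open>y\<close>, even where \<open>f\<close> is not convex.
\<close>

lemma fenchel_conj_strongly_convex:
  fixes f :: "'a::real_inner \<Rightarrow> real"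
  assumes g: "\<And>y. fenchel_conj (\<lambda>x. ereal (f x)) y = ereal (g y)"
    and hyp: "hypoconvex_real (- l) (\<lambda>x. - f x)" and l: "l > 0"
  shows "hypoconvex_real (1 / l) g"
proof (rule hypoconvex_realI)
  fix y1 y2 :: 'a and t :: real
  assume t: "0 < t" "t < 1"
  define z where "z = (1 - t) *\<^sub>R y1 + t *\<^sub>R y2"
  define Q where "Q = (norm (y1 - y2))\<^sup>2 / l"
  have "g z \<le> (1 - t) * g y1 + t * g y2 - 1 / l / 2 * (t * (1 - t)) * (norm (y1 - y2))\<^sup>2"
  proof (rule fenchel_conj_le[of "\<lambda>x. ereal (f x)" _ g, OF g])
    show "proper (\<lambda>x. ereal (f x))" by (simp add: proper_def)
    fix x r assume "ereal (f x) = ereal r"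
    then have r: "r = f x" by simp
    \<comment> \<open>A competitor \<open>x\<close> at \<open>z\<close> is moved to each end with \<open>u = x - z / l\<close> fixed.\<close>
    define x1 where "x1 = x + (1 / l) *\<^sub>R (y1 - z)"
    define x2 where "x2 = x + (1 / l) *\<^sub>R (y2 - z)"
    have "(1 - t) *\<^sub>R (y1 - z) + t *\<^sub>R (y2 - z) = 0" by (simp add: z_def algebra_simps)
    moreover have "(1 - t) *\<^sub>R (x + k *\<^sub>R (y1 - z)) + t *\<^sub>R (x + k *\<^sub>R (y2 - z))
        = x + k *\<^sub>R ((1 - t) *\<^sub>R (y1 - z) + t *\<^sub>R (y2 - z))" for k
      by (simp add: algebra_simps)
    ultimately have mid: "(1 - t) *\<^sub>R x1 + t *\<^sub>R x2 = x"
      unfolding x1_def x2_def by simp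
    have d: "x1 - x2 = (1 / l) *\<^sub>R (y1 - y2)" by (simp add: x1_def x2_def algebra_simps)
    have e: "1 / l / 2 * (t * (1 - t)) * (norm (y1 - y2))\<^sup>2 = t * (1 - t) * (Q / 2)"
      by (simp add: Q_def)
    have "x1 \<bullet> y1 - f x1 \<le> g y1" "x2 \<bullet> y2 - f x2 \<le> g y2"
      by (rule fenchel_conj_ge[of "\<lambda>x. ereal (f x)" _ g, OF g]; simp)+
    then have "(1 - t) * (x1 \<bullet> y1 - f x1) + t * (x2 \<bullet> y2 - f x2) \<le> (1 - t) * g y1 + t * g y2"
      using t by (intro add_mono mult_left_mono) auto
    moreover have "(1 - t) * f x1 + t * f x2 \<le> f x + t * (1 - t) * (Q / 2)"
    proof -
      have "l / 2 * (t * (1 - t)) * (norm (x1 - x2))\<^sup>2 = t * (1 - t) * (Q / 2)"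
        unfolding d Q_def using l by (simp add: power2_eq_square)
      moreover have "- f x \<le> (1 - t) * - f x1 + t * - f x2
          - - l / 2 * (t * (1 - t)) * (norm (x1 - x2))\<^sup>2"
        using hypoconvex_realD[OF hyp, of t x1 x2] t unfolding mid by simp
      ultimately show ?thesis by linarith
    qed
    moreover have "x \<bullet> z = (1 - t) * (x1 \<bullet> y1) + t * (x2 \<bullet> y2) - t * (1 - t) * Q"
      unfolding mid[symmetric] z_def inner_convex_comb d Q_def by (simp add: power2_norm_eq_inner)
    ultimately show "x \<bullet> z - r
        \<le> (1 - t) * g y1 + t * g y2 - 1 / l / 2 * (t * (1 - t)) * (norm (y1 - y2))\<^sup>2"
      unfolding r e by (simp add: field_simps)
  qed
  then show "g ((1 - t) *\<^sub>R y1 + t *\<^sub>R y2)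
      \<le> (1 - t) * g y1 + t * g y2 - 1 / l / 2 * (t * (1 - t)) * (norm (y1 - y2))\<^sup>2"
    by (simp add: z_def)
qed

section \<open>The double envelope as a Moreau envelope of the conjugate\<close>

text \<open>
  Expanding \<open>\<bar>z - w\<bar>\<^sup>2\<close> moves the term \<open>\<bar>z\<bar>\<^sup>2 / (2 lam)\<close> to \<open>h\<close> and leaves a linear term in \<open>z\<close>, so that the
  infimum is a conjugate.
\<close>

lemma moreau_env_eq_fenchel_conj:
  fixes h :: "'a::real_inner \<Rightarrow> ereal"
  assumes g: "\<And>y. fenchel_conj (\<lambda>z. h z + ereal (inverse lam * (1 / 2 * (norm z)\<^sup>2))) y = ereal (g y)"
    and h: "proper h" and lam: "lam > 0"
  shows "moreau_env lam h w = ereal (1 / (2 * lam) * (norm w)\<^sup>2 - g ((1 / lam) *\<^sub>R w))"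
proof -
  define f where "f = (\<lambda>z. h z + ereal (inverse lam * (1 / 2 * (norm z)\<^sup>2)))"
  note g = g[folded f_def]
  have f: "proper f" using h by (auto simp: proper_def f_def)
  have sq: "1 / (2 * lam) * (norm (z - w))\<^sup>2
      = inverse lam * (1 / 2 * (norm z)\<^sup>2) - z \<bullet> ((1 / lam) *\<^sub>R w) + 1 / (2 * lam) * (norm w)\<^sup>2" for z
    using lam unfolding power2_norm_eq_inner
    by (simp add: inner_diff_left inner_diff_right inner_commute field_simps)
  have lower: "ereal (1 / (2 * lam) * (norm w)\<^sup>2 - g ((1 / lam) *\<^sub>R w)) \<le> moreau_env lam h w"
    unfolding moreau_env_def
  proof (rule INF_greatest)
    fix z
    show "ereal (1 / (2 * lam) * (norm w)\<^sup>2 - g ((1 / lam) *\<^sub>R w))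
        \<le> h z + ereal (1 / (2 * lam) * (norm (z - w))\<^sup>2)"
    proof (cases "h z")
      case (real r)
      then have "z \<bullet> ((1 / lam) *\<^sub>R w) - (r + inverse lam * (1 / 2 * (norm z)\<^sup>2)) \<le> g ((1 / lam) *\<^sub>R w)"
        by (intro fenchel_conj_ge[where f = f and g = g, OF g]) (simp add: f_def)
      then show ?thesis unfolding sq real by simp
    qed (use h in \<open>auto simp: proper_def\<close>)
  qed
  obtain z0 r0 where z0: "h z0 = ereal r0"
    using h unfolding proper_def by (metis ereal_cases)
  have upper: "moreau_env lam h w \<le> ereal (r + 1 / (2 * lam) * (norm (z - w))\<^sup>2)"
    if "h z = ereal r" for z r
    unfolding moreau_env_def by (rule INF_lower2[of z]) (auto simp: that)
  obtain i where i: "moreau_env lam h w = ereal i"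
    using lower upper[OF z0] by (cases "moreau_env lam h w") auto
  have "g ((1 / lam) *\<^sub>R w) \<le> 1 / (2 * lam) * (norm w)\<^sup>2 - i"
  proof (rule fenchel_conj_le[where f = f and g = g, OF g f])
    fix z r assume "f z = ereal r"
    then have "h z = ereal (r - inverse lam * (1 / 2 * (norm z)\<^sup>2))"
      by (cases "h z") (auto simp: f_def)
    from upper[OF this] show "z \<bullet> ((1 / lam) *\<^sub>R w) - r \<le> 1 / (2 * lam) * (norm w)\<^sup>2 - i"
      unfolding sq i by simp
  qed
  then show ?thesis using lower i by simp
qed

text \<open>
  The concave part \<open>- g (w / lam)\<close> of the first envelope turns the outer supremum into a convex
  minimization. In the variable \<open>u = w / lam\<close> its quadratic part has weight
  \<open>lam\<^sup>2 / mu - lam = c\<close> and centre \<open>x / (lam - mu)\<close>, which is the origin of \<open>c\<close> and of the argument of \<open>P\<close>.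
\<close>

lemma lasry_lions_env_eq:
  fixes h :: "'a::real_inner \<Rightarrow> ereal"
  assumes g: "\<And>y. fenchel_conj (\<lambda>z. h z + ereal (inverse lam * (1 / 2 * (norm z)\<^sup>2))) y = ereal (g y)"
    and h: "proper h" and mu: "0 < mu" "mu < lam"
    and P: "\<And>y. is_prox (lam * (lam - mu) / mu) g y (P y)"
  shows "lasry_lions_env lam mu h x
    = ereal (1 / (2 * (lam - mu)) * (norm x)\<^sup>2
        - env_via (lam * (lam - mu) / mu) g P ((1 / (lam - mu)) *\<^sub>R x))"
proof -
  define d where "d = lam - mu"
  define c where "c = lam * d / mu"
  have pos: "d > 0" "lam > 0" "c > 0" using mu by (auto simp: d_def c_def)
  have lam: "lam = mu + d" by (simp add: d_def)
  note P = P[folded d_def, folded c_def]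
  define y where "y = (1 / d) *\<^sub>R x"
  define B where "B = (\<lambda>w. g ((1 / lam) *\<^sub>R w) - 1 / (2 * lam) * (norm w)\<^sup>2 + 1 / (2 * mu) * (norm (w - x))\<^sup>2)"
  have square: "B (lam *\<^sub>R u) = g u + c / 2 * (norm (u - y))\<^sup>2 - 1 / (2 * d) * (norm x)\<^sup>2" for u
  proof -
    define U V X where "U = u \<bullet> u" and "V = u \<bullet> x" and "X = x \<bullet> x"
    have 1: "(norm (lam *\<^sub>R u))\<^sup>2 = lam\<^sup>2 * U"
      unfolding power2_norm_eq_inner by (simp add: U_def power2_eq_square)
    have 2: "(norm (lam *\<^sub>R u - x))\<^sup>2 = lam\<^sup>2 * U - 2 * lam * V + X"
      unfolding power2_norm_eq_inner
      by (simp add: U_def V_def X_def inner_simps inner_commute power2_eq_square)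
    have 3: "(norm (u - y))\<^sup>2 = U - 2 * V / d + X / d\<^sup>2"
      unfolding power2_norm_eq_inner y_def
      by (simp add: U_def V_def X_def inner_simps inner_commute power2_eq_square)
    have 4: "(norm x)\<^sup>2 = X" by (simp add: power2_norm_eq_inner X_def)
    have "- (1 / (2 * lam) * (lam\<^sup>2 * U)) + 1 / (2 * mu) * (lam\<^sup>2 * U - 2 * lam * V + X)
        = c / 2 * (U - 2 * V / d + X / d\<^sup>2) - 1 / (2 * d) * X"
      unfolding c_def using pos mu by (simp add: field_simps power2_eq_square) (simp add: lam algebra_simps)
    moreover have "B (lam *\<^sub>R u) = g u - 1 / (2 * lam) * (norm (lam *\<^sub>R u))\<^sup>2
        + 1 / (2 * mu) * (norm (lam *\<^sub>R u - x))\<^sup>2"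
      using pos by (simp add: B_def)
    ultimately show ?thesis unfolding 1 2 3 4 by linarith
  qed
  have "(INF w. ereal (B w)) = ereal (B (lam *\<^sub>R P y))"
  proof (rule antisym)
    show "(INF w. ereal (B w)) \<le> ereal (B (lam *\<^sub>R P y))" by (rule INF_lower) simp
    show "ereal (B (lam *\<^sub>R P y)) \<le> (INF w. ereal (B w))"
    proof (rule INF_greatest)
      fix w
      have "B (lam *\<^sub>R P y) \<le> B (lam *\<^sub>R ((1 / lam) *\<^sub>R w))"
        unfolding square using P[of y] by (simp add: is_prox_def)
      then show "ereal (B (lam *\<^sub>R P y)) \<le> ereal (B w)" using pos by simp
    qed
  qed
  then have "lasry_lions_env lam mu h x = - ereal (B (lam *\<^sub>R P y))"
    unfolding lasry_lions_env_def moreau_env_def[of mu]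
      moreau_env_eq_fenchel_conj[where g = g, OF g h pos(2)]
    by (simp add: B_def)
  then show ?thesis
    unfolding square by (simp add: env_via_def c_def d_def y_def)
qed

section \<open>Curvature of the double envelope\<close>

text \<open>
  The set of curvature constants is bounded above by any one quotient of the gradient, which exists
  because a Euclidean space has a nonzero vector. The supremum is characterized through the gradient
  inequality, which is visibly closed under suprema of \<open>a\<close>.
\<close>

lemma best_curvature:
  fixes F :: "'a::euclidean_space \<Rightarrow> real"
  assumes "hypoconvex_real a0 F" and der: "\<And>x. GDERIV F x :> G x"
  obtains \<sigma> where "\<And>x y. \<sigma> * (norm (x - y))\<^sup>2 \<le> (G x - G y) \<bullet> (x - y)"
    and "\<And>a. hypoconvex_real a F \<Longrightarrow> a \<le> \<sigma>"
proof -
  let ?S = "{a. hypoconvex_real a F}"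
  have quotient: "a \<le> (G x - G y) \<bullet> (x - y) / (norm (x - y))\<^sup>2"
    if "hypoconvex_real a F" "x \<noteq> y" for a x y
    using hypoconvex_real_gradient[OF that(1) der, of x y] that(2) by (simp add: le_divide_eq)
  obtain e :: 'a where "e \<in> Basis" using nonempty_Basis by blast
  then have "e \<noteq> 0" by (rule nonzero_Basis)
  then have bdd: "bdd_above ?S" using quotient[of _ e 0] by (intro bdd_aboveI) blast
  have "Sup ?S * (norm (x - y))\<^sup>2 \<le> (G x - G y) \<bullet> (x - y)" for x y
  proof (cases "x = y")
    case False
    have "Sup ?S \<le> (G x - G y) \<bullet> (x - y) / (norm (x - y))\<^sup>2"
      using quotient[OF _ False] assms(1) by (intro cSup_least) auto
    then show ?thesis using False by (simp add: le_divide_eq)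
  qed simp
  moreover have "a \<le> Sup ?S" if "hypoconvex_real a F" for a
    using that bdd by (intro cSup_upper) auto
  ultimately show ?thesis by (rule that)
qed

lemma hypoconvex_add_quadratic:
  fixes h :: "'a::real_inner \<Rightarrow> ereal"
  assumes "hypoconvex \<sigma> h"
  shows "hypoconvex (\<sigma> + inverse lam) (\<lambda>z. h z + ereal (inverse lam * (1 / 2 * (norm z)\<^sup>2)))"
proof -
  have "h z + ereal (inverse lam * (1 / 2 * (norm z)\<^sup>2)) - ereal ((\<sigma> + inverse lam) / 2 * (norm z)\<^sup>2)
      = h z - ereal (\<sigma> / 2 * (norm z)\<^sup>2)" for z
    by (cases "h z") (auto simp: algebra_simps add_divide_distrib)
  then show ?thesis using assms by (simp add: hypoconvex_def)
qed

text \<open>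
  Cauchy--Schwarz bounds the curvature of \<open>h\<close> by \<open>L\<close> on both sides. The upper side is stated, since it
  is the one that survives the convexification of \<open>h + (1 / (2 lam)) norm\<^sup>2\<close> in the conjugate.
\<close>

lemma L_smooth_neg_hypoconvex_real:
  assumes "L_smooth L h"
  shows "hypoconvex_real (- L) (\<lambda>x. - real_of_ereal (h x))"
proof -
  obtain g where g: "has_gradient h g" "L-lipschitz_on UNIV g"
    using assms by (auto simp: L_smooth_def)
  show ?thesis
  proof (rule gradient_monotone_imp_hypoconvex_real)
    show "GDERIV (\<lambda>x. - real_of_ereal (h x)) x :> - g x" for x
      using g(1) by (auto simp: has_gradient_def intro: GDERIV_minus)
    show "- L * (norm (x - y))\<^sup>2 \<le> (- g x - - g y) \<bullet> (x - y)" for x y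
    proof -
      have "(g x - g y) \<bullet> (x - y) \<le> norm (g x - g y) * norm (x - y)"
        by (rule norm_cauchy_schwarz)
      also have "\<dots> \<le> L * norm (x - y) * norm (x - y)"
        using lipschitz_onD[OF g(2), of x y] by (intro mult_right_mono) (auto simp: dist_norm)
      finally show ?thesis
        by (simp add: power2_eq_square inner_diff_left algebra_simps)
    qed
  qed
qed

theorem mainTheorem2:
  fixes h :: "real ^ 'n \<Rightarrow> ereal" and \<gamma>h :: ereal and lam mu :: real
  assumes "proper h" and "lower_semicontinuous h" and "prox_bounded \<gamma>h h"
    and "0 < mu" and "mu < lam" and "ereal lam < \<gamma>h"
  defines "c \<equiv> lam * (lam - mu) / mu"
  shows "\<exists>P G \<sigma>1 \<sigma>2 L.
     (\<forall>x. prox (inverse c) (fenchel_conj (\<lambda>z. h z + ereal (inverse lam * (1 / 2 * (norm z)\<^sup>2))))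
             ((1 / (lam - mu)) *\<^sub>R x) = {P x}) \<and>
     G = (\<lambda>x. (lam / mu) *\<^sub>R P x - (1 / mu) *\<^sub>R x) \<and>
     has_gradient (lasry_lions_env lam mu h) G \<and>
     L-lipschitz_on UNIV G \<and>
     two_sided_bound \<sigma>1 \<sigma>2 G \<and>
     \<sigma>1 \<ge> - 1 / mu \<and> \<sigma>2 \<ge> - 1 / (lam - mu) \<and>
     L \<le> max (1 / mu) (1 / (lam - mu)) \<and>
     (\<forall>\<sigma>h. hypoconvex \<sigma>h h \<and> 1 + (lam - mu) * \<sigma>h > 0 \<longrightarrow>
        \<sigma>1 \<ge> \<sigma>h / (1 + (lam - mu) * \<sigma>h) \<and>
        L \<le> max (\<bar>\<sigma>h\<bar> / (1 + (lam - mu) * \<sigma>h)) (1 / (lam - mu))) \<and>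
     (\<forall>Lh. L_smooth Lh h \<longrightarrow>
        \<sigma>2 \<ge> - (Lh / (1 + (lam - mu) * Lh)) \<and>
        L \<le> max (1 / mu) (Lh / (1 + (lam - mu) * Lh)) \<and>
        (\<forall>\<sigma>h. hypoconvex \<sigma>h h \<and> \<sigma>h \<ge> - Lh / (1 + 2 * (lam - mu) * Lh) \<longrightarrow>
           L \<le> Lh / (1 + (lam - mu) * Lh)))"
proof -
  define d where "d = lam - mu"
  define f where "f = (\<lambda>z. h z + ereal (inverse lam * (1 / 2 * (norm z)\<^sup>2)))"
  define g where "g = (\<lambda>y. real_of_ereal (fenchel_conj f y))"
  have d: "d > 0" and lam: "lam > 0" and lam_eq: "lam = mu + d" and mu: "mu > 0"
    using assms(4,5) by (auto simp: d_def)
  have c_eq: "c = lam * d / mu" by (simp add: c_def d_def)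
  have c: "c > 0" using d lam mu by (simp add: c_eq)
  have f_proper: "proper f" using assms(1) by (auto simp: proper_def f_def)

  obtain \<gamma> m where \<gamma>: "lam < \<gamma>" "\<And>x. ereal m \<le> h x + ereal (1 / (2 * \<gamma>) * (norm x)\<^sup>2)"
    using assms(3,6) by (auto simp: prox_bounded_def prox_bounds_def less_SUP_iff)
  \<comment> \<open>Since \<open>lam < \<gamma>\<close>, the square added to \<open>h\<close> outweighs the one that bounds \<open>h\<close> below.\<close>
  define \<epsilon> where "\<epsilon> = 1 / (2 * lam) - 1 / (2 * \<gamma>)"
  have "\<epsilon> > 0" using \<gamma>(1) lam by (simp add: \<epsilon>_def frac_less2)
  have "ereal (m + \<epsilon> * (norm z)\<^sup>2) \<le> f z" for z
  proof -
    have "inverse lam * (1 / 2 * (norm z)\<^sup>2) = 1 / (2 * \<gamma>) * (norm z)\<^sup>2 + \<epsilon> * (norm z)\<^sup>2"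
      by (simp add: \<epsilon>_def algebra_simps inverse_eq_divide)
    then show ?thesis using \<gamma>(2)[of z] by (cases "h z") (auto simp: f_def add_divide_distrib)
  qed
  from fenchel_conj_finite[OF f_proper \<open>\<epsilon> > 0\<close> this]
  have g: "fenchel_conj f y = ereal (g y)" for y
    by (simp add: g_def ereal_real)
  have g_conv: "hypoconvex_real 0 g"
    by (rule fenchel_conj_convex[where g = g, OF g f_proper])

  obtain x0 r0 where x0: "f x0 = ereal r0"
    using f_proper unfolding proper_def by (metis ereal_cases)
  have minor: "x0 \<bullet> w - r0 \<le> g w" for w
    by (rule fenchel_conj_ge[where g = g, OF g]) (simp add: x0)
  have "\<exists>p. is_prox c g y p" for y
    using ex_prox[OF g_conv c minor] by blast
  then obtain Q where Q: "\<And>y. is_prox c g y (Q y)" by metis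
  have prox: "prox (inverse c) (fenchel_conj f) y = {Q y}" for y
  proof -
    have "fenchel_conj f = (\<lambda>w. ereal (g w))" using g by auto
    then show ?thesis
      using Q[of y] prox_unique[OF g_conv c] by (auto simp: prox_ereal_eq[OF c])
  qed

  define e where "e = env_via c g Q"
  define F where "F = (\<lambda>x. - e ((1 / d) *\<^sub>R x) + 1 / d / 2 * (norm x)\<^sup>2)"
  define P where "P = (\<lambda>x. Q ((1 / d) *\<^sub>R x))"
  define G where "G = (\<lambda>x. (lam / mu) *\<^sub>R P x - (1 / mu) *\<^sub>R x)"
  have env: "lasry_lions_env lam mu h x = ereal (F x)" for x
    using lasry_lions_env_eq[where g = g and P = Q, OF g[unfolded f_def] assms(1,4,5) Q[unfolded c_def]]
    by (simp add: F_def e_def c_def d_def)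

  have dF: "GDERIV F x :> G x" for x
  proof -
    let ?y = "(1 / d) *\<^sub>R x"
    have "(e has_derivative (\<lambda>h. h \<bullet> c *\<^sub>R (?y - P x))) (at ?y)"
      using env_gradient[OF g_conv c Q, of ?y] by (simp add: e_def P_def gderiv_def)
    moreover have "((\<lambda>x. (1 / d) *\<^sub>R x) has_derivative (\<lambda>h. (1 / d) *\<^sub>R h)) (at x)"
      by (auto intro!: derivative_eq_intros)
    ultimately have "(e \<circ> (\<lambda>x. (1 / d) *\<^sub>R x) has_derivative
        (\<lambda>h. h \<bullet> c *\<^sub>R (?y - P x)) \<circ> (\<lambda>h. (1 / d) *\<^sub>R h)) (at x)"
      by (rule diff_chain_at[rotated])
    then have "((\<lambda>x. - e ((1 / d) *\<^sub>R x) + 1 / d / 2 * (x \<bullet> x)) has_derivative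
        (\<lambda>h. - (((1 / d) *\<^sub>R h) \<bullet> c *\<^sub>R (?y - P x)) + 1 / d / 2 * (x \<bullet> h + h \<bullet> x))) (at x)"
      unfolding o_def
      by (intro has_derivative_add has_derivative_minus has_derivative_mult_right
          has_derivative_inner has_derivative_ident)
    moreover have "- (((1 / d) *\<^sub>R h) \<bullet> c *\<^sub>R (?y - P x)) + 1 / d / 2 * (x \<bullet> h + h \<bullet> x) = h \<bullet> G x" for h
    proof -
      have "1 / d - c / d\<^sup>2 = - (1 / mu)" "c / d = lam / mu"
        using d lam mu unfolding c_eq
        by (simp_all add: field_simps power2_eq_square) (simp add: lam_eq algebra_simps)
      then have "h \<bullet> G x = c / d * (h \<bullet> P x) + (1 / d - c / d\<^sup>2) * (h \<bullet> x)"
        by (simp add: G_def inner_diff_right)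
      then show ?thesis
        by (simp add: inner_diff_right inner_commute power2_eq_square algebra_simps)
    qed
    ultimately show ?thesis
      by (simp add: F_def gderiv_def power2_norm_eq_inner)
  qed
  have dF': "GDERIV (\<lambda>x. - F x) x :> - G x" for x
    by (rule GDERIV_minus[OF dF])

  have F_lower: "hypoconvex_real (1 / d - \<kappa> / d\<^sup>2) F" if "hypoconvex_real (- \<kappa>) (\<lambda>y. - e y)" for \<kappa>
    using hypoconvex_real_scale_add_quadratic[OF that, of "1 / d" "1 / d"]
    by (simp add: F_def power_divide)
  have F_upper: "hypoconvex_real (\<kappa> / d\<^sup>2 - 1 / d) (\<lambda>x. - F x)" if "hypoconvex_real \<kappa> e" for \<kappa>
    using hypoconvex_real_scale_add_quadratic[OF that, of "1 / d" "- 1 / d"]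
    by (simp add: F_def power_divide)
  have lower_mu: "hypoconvex_real (- 1 / mu) F"
  proof -
    have "1 / d - c / d\<^sup>2 = - 1 / mu"
      using d lam mu unfolding c_eq
      by (simp add: field_simps power2_eq_square) (simp add: lam_eq algebra_simps)
    then show ?thesis
      using F_lower[of c] env_neg_hypoconvex_parameter[where P = Q, OF Q] by (simp add: e_def)
  qed
  have upper_d: "hypoconvex_real (- 1 / d) (\<lambda>x. - F x)"
    using F_upper[of 0] env_hypoconvex[where P = Q, OF g_conv _ c Q] by (simp add: e_def)

  have frac: "1 / d - d / D / d\<^sup>2 = (D - 1) / (d * D)" if "D > 0" for D
    using that d by (simp add: field_simps power2_eq_square)
  have lower_hypo: "hypoconvex_real (\<sigma> / (1 + d * \<sigma>)) F"
    if hyp: "hypoconvex \<sigma> h" and den: "1 + d * \<sigma> > 0" for \<sigma>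
  proof (cases "\<sigma> + inverse lam > 0")
    case True
    define \<tau> where "\<tau> = \<sigma> + inverse lam"
    have \<tau>: "\<tau> > 0" using True by (simp add: \<tau>_def)
    have "hypoconvex_real (- (1 / \<tau>)) (\<lambda>y. - g y)"
      using hypoconvex_add_quadratic[OF hyp, of lam]
      by (intro fenchel_conj_of_strongly_convex[OF g f_proper _ \<tau>]) (simp add: f_def \<tau>_def)
    from env_neg_hypoconvex[where P = Q, OF this _ c Q]
    have "hypoconvex_real (- (1 / \<tau> * c / (1 / \<tau> + c))) (\<lambda>y. - e y)"
      using \<tau> by (simp add: e_def)
    from F_lower[OF this] have "hypoconvex_real (1 / d - 1 / \<tau> * c / (1 / \<tau> + c) / d\<^sup>2) F" .
    moreover have "1 / d - 1 / \<tau> * c / (1 / \<tau> + c) / d\<^sup>2 = \<sigma> / (1 + d * \<sigma>)"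
    proof -
      have "1 / \<tau> * c / (1 / \<tau> + c) = c / (1 + c * \<tau>)"
        using \<tau> c by (simp add: field_simps)
      also have "1 + c * \<tau> = lam * (1 + d * \<sigma>) / mu"
        unfolding c_eq \<tau>_def using lam mu by (simp add: field_simps) (simp add: lam_eq algebra_simps)
      also have "c / (lam * (1 + d * \<sigma>) / mu) = d / (1 + d * \<sigma>)"
        using lam mu by (simp add: c_eq)
      finally have e: "1 / \<tau> * c / (1 / \<tau> + c) = d / (1 + d * \<sigma>)" .
      show ?thesis
        unfolding e using d frac[OF den] by simp
    qed
    ultimately show ?thesis by simp
  next
    case False
    \<comment> \<open>Here the claimed bound is at most \<open>- 1 / mu\<close>: the fraction increases with \<open>\<sigma>\<close>,
      and equals \<open>- 1 / mu\<close> at \<open>\<sigma> = - 1 / lam\<close>.\<close>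
    then have "lam * \<sigma> \<le> - 1" using lam by (simp add: field_simps)
    then have "\<sigma> / (1 + d * \<sigma>) \<le> - 1 / mu"
      using den mu by (simp add: lam_eq field_simps)
    then show ?thesis by (rule hypoconvex_real_mono[OF lower_mu])
  qed
  have upper_smooth: "hypoconvex_real (- (L / (1 + d * L))) (\<lambda>x. - F x)" and L_nonneg: "L \<ge> 0"
    if smooth: "L_smooth L h" for L
  proof -
    show L: "L \<ge> 0" using smooth by (auto simp: L_smooth_def lipschitz_on_def)
    define l where "l = L + inverse lam"
    have l: "l > 0" using L lam by (simp add: l_def add_nonneg_pos)
    define f' where "f' = (\<lambda>z. real_of_ereal (h z) + inverse lam / 2 * (norm z)\<^sup>2)"
    have "\<bar>h z\<bar> \<noteq> \<infinity>" for z using smooth by (auto simp: L_smooth_def has_gradient_def)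
    then have f': "f = (\<lambda>z. ereal (f' z))"
      unfolding f_def f'_def by (auto simp: ereal_real fun_eq_iff simp flip: plus_ereal.simps)
    have "hypoconvex_real (- l) (\<lambda>z. - f' z)"
      using hypoconvex_real_scale_add_quadratic
        [OF L_smooth_neg_hypoconvex_real[OF smooth], of 1 "- inverse lam"]
      by (simp add: l_def f'_def)
    then have "hypoconvex_real (1 / l) g"
      by (rule fenchel_conj_strongly_convex[OF g[unfolded f'] _ l])
    from env_hypoconvex[where P = Q, OF this _ c Q]
    have "hypoconvex_real (1 / l * c / (1 / l + c)) e"
      using l by (simp add: e_def)
    from F_upper[OF this]
    have "hypoconvex_real (1 / l * c / (1 / l + c) / d\<^sup>2 - 1 / d) (\<lambda>x. - F x)" .
    moreover have "1 / l * c / (1 / l + c) / d\<^sup>2 - 1 / d = - (L / (1 + d * L))"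
    proof -
      have den: "1 + d * L > 0" using d L by (simp add: add_pos_nonneg)
      have "1 / l * c / (1 / l + c) = c / (1 + c * l)"
        using l c by (simp add: field_simps)
      also have "1 + c * l = lam * (1 + d * L) / mu"
        unfolding c_eq l_def using lam mu by (simp add: field_simps) (simp add: lam_eq algebra_simps)
      also have "c / (lam * (1 + d * L) / mu) = d / (1 + d * L)"
        using lam mu by (simp add: c_eq)
      finally have e: "1 / l * c / (1 / l + c) = d / (1 + d * L)" .
      show ?thesis
        unfolding e using d frac[OF den] by simp
    qed
    ultimately show "hypoconvex_real (- (L / (1 + d * L))) (\<lambda>x. - F x)" by simp
  qed

  obtain \<sigma>1 where \<sigma>1: "\<And>x y. \<sigma>1 * (norm (x - y))\<^sup>2 \<le> (G x - G y) \<bullet> (x - y)"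
      "\<And>a. hypoconvex_real a F \<Longrightarrow> a \<le> \<sigma>1"
    by (rule best_curvature[OF lower_mu dF]) blast
  obtain \<sigma>2 where \<sigma>2: "\<And>x y. \<sigma>2 * (norm (x - y))\<^sup>2 \<le> (- G x - - G y) \<bullet> (x - y)"
      "\<And>a. hypoconvex_real a (\<lambda>x. - F x) \<Longrightarrow> a \<le> \<sigma>2"
    by (rule best_curvature[OF upper_d dF']) blast
  have upper: "(G x - G y) \<bullet> (x - y) \<le> - \<sigma>2 * (norm (x - y))\<^sup>2" for x y
    using \<sigma>2(1)[of x y] by (simp add: inner_diff_left)
  have order: "\<sigma>1 \<le> - \<sigma>2"
  proof -
    obtain b :: "real ^ 'n" where "b \<in> Basis" using nonempty_Basis by blast
    then have "norm (b - 0) = 1" by simp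
    then show ?thesis using \<sigma>1(1)[of b 0] upper[of b 0] by simp
  qed
  define L where "L = max (- \<sigma>1) (- \<sigma>2)"
  have lip: "L-lipschitz_on UNIV G"
    by (rule two_sided_imp_lipschitz[OF dF \<sigma>1(1) upper _ order]) (auto simp: L_def)
  have b1: "- 1 / mu \<le> \<sigma>1" by (rule \<sigma>1(2)[OF lower_mu])
  have b2: "- 1 / d \<le> \<sigma>2" by (rule \<sigma>2(2)[OF upper_d])
  have hypo: "\<sigma> / (1 + d * \<sigma>) \<le> \<sigma>1 \<and> L \<le> max (\<bar>\<sigma>\<bar> / (1 + d * \<sigma>)) (1 / d)"
    if "hypoconvex \<sigma> h" "1 + d * \<sigma> > 0" for \<sigma>
  proof -
    have 1: "\<sigma> / (1 + d * \<sigma>) \<le> \<sigma>1" by (rule \<sigma>1(2)[OF lower_hypo[OF that]])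
    have "- \<sigma> / (1 + d * \<sigma>) \<le> \<bar>\<sigma>\<bar> / (1 + d * \<sigma>)"
      using that(2) by (intro divide_right_mono) auto
    then have "- \<sigma>1 \<le> \<bar>\<sigma>\<bar> / (1 + d * \<sigma>)" using 1 by simp
    then show ?thesis using 1 b2 by (auto simp: L_def le_max_iff_disj)
  qed
  have smooth: "- (l / (1 + d * l)) \<le> \<sigma>2 \<and> L \<le> max (1 / mu) (l / (1 + d * l)) \<and>
      (\<forall>\<sigma>. hypoconvex \<sigma> h \<and> \<sigma> \<ge> - l / (1 + 2 * d * l) \<longrightarrow> L \<le> l / (1 + d * l))"
    if "L_smooth l h" for l
  proof -
    have 2: "- (l / (1 + d * l)) \<le> \<sigma>2" by (rule \<sigma>2(2)[OF upper_smooth[OF that]])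
    have "L \<le> l / (1 + d * l)" if hyp: "hypoconvex \<sigma> h" and \<sigma>: "\<sigma> \<ge> - l / (1 + 2 * d * l)" for \<sigma>
    proof -
      have dl: "d * l \<ge> 0" using d L_nonneg[OF \<open>L_smooth l h\<close>] by simp
      have key: "- l \<le> \<sigma> * (1 + 2 * d * l)"
      proof -
        have "0 < 1 + 2 * d * l" using dl by (simp add: mult.assoc add_pos_nonneg)
        from pos_divide_le_eq[OF this, of "- l" \<sigma>] \<sigma> show ?thesis by blast
      qed
      then have "d * - l \<le> d * (\<sigma> * (1 + 2 * d * l))"
        using d by (intro mult_left_mono) auto
      then have "0 < (1 + d * \<sigma>) * (1 + 2 * d * l)"
        using dl by (simp add: algebra_simps)
      then have den: "1 + d * \<sigma> > 0"
        using dl by (simp add: zero_less_mult_iff)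
      \<comment> \<open>The threshold for \<open>\<sigma>\<close> is where minus the lower curvature bound meets the upper one.\<close>
      have "- (\<sigma> / (1 + d * \<sigma>)) \<le> l / (1 + d * l)"
        using key den dl by (simp add: field_simps)
      then show ?thesis
        using hypo[OF hyp den] 2 by (auto simp: L_def)
    qed
    then show ?thesis using 2 b1 by (auto simp: L_def le_max_iff_disj)
  qed
  show ?thesis
    unfolding d_def[symmetric] f_def[symmetric]
  proof (intro exI conjI)
    show "\<forall>x. prox (inverse c) (fenchel_conj f) ((1 / d) *\<^sub>R x) = {P x}"
      by (simp add: prox P_def)
    show "G = (\<lambda>x. (lam / mu) *\<^sub>R P x - (1 / mu) *\<^sub>R x)" by (rule G_def)
    show "has_gradient (lasry_lions_env lam mu h) G"
      using dF by (simp add: has_gradient_def env)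
    show "L-lipschitz_on UNIV G" by (rule lip)
    show "two_sided_bound \<sigma>1 \<sigma>2 G"
      using \<sigma>1(1) upper by (simp add: two_sided_bound_def)
    show "- 1 / mu \<le> \<sigma>1" "- 1 / d \<le> \<sigma>2" by (rule b1 b2)+
    show "L \<le> max (1 / mu) (1 / d)"
      using b1 b2 by (auto simp: L_def le_max_iff_disj)
  qed (use hypo smooth in blast)+
qed

end
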